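(* Let $m\ge1$. (Symmetric class.) For $(a_0,\dots,a_m)\in\mathbb C^{m+1}$ put $a_{-j}=a_j$ $(1\le j\le m)$, $a_s=0$ for $|s|>m$, $D_n=\det(a_{j-i})_{i,j=1}^n$, and $d=\frac{3^m+1}2$. Then $H=\det(D_{i+j})_{0\le i,j<d}$ is a nonzero polynomial in $a_0,\dots,a_m$, and at every parameter point with $H\neq0$ the minimal recurrence degree of $(D_n)_{n\ge0}$ is exactly $\frac{3^m+1}2$. (Skew-symmetric class.) For $(a_1,\dots,a_m)\in\mathbb C^m$ put $a_0=0$, $a_{-j}=-a_j$ $(1\le j\le m)$, $a_s=0$ for $|s|>m$, $D_n=\det(a_{j-i})_{i,j=1}^n$, and $d=2\cdot3^{m-1}$. Then $H=\det(D_{i+j})_{0\le i,j<d}$ is a nonzero polynomial in $a_1,\dots,a_m$, and at every parameter point with $H\ne0$ the minimal recurrence degree of $(D_n)_{n\ge0}$ is exactly $2\cdot3^{m-1}$. Equivalently, these degrees are generic: a drop of the minimal recurrence degree below these values can occur only on the proper algebraic set $H=0$.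
   Context: $D_0=1$. The minimal recurrence degree of $(u_n)_{n\ge0}$ is the least $d$ for which there are constants $c_1,\dots,c_d$ with $u_{n+d}+c_1u_{n+d-1}+\dots+c_du_n=0$ for all $n\ge0$. *)

theory Defs
  imports
    Complex_Main
    "HOL-Library.Poly_Mapping"
    "Jordan_Normal_Form.Determinant"
begin

text \<open>
  Multivariate polynomials over \<open>\<complex>\<close> are finitely supported maps from monomials
  (exponent vectors) to coefficients, with the convolution product of \<^theory>\<open>HOL-Library.Poly_Mapping\<close>.
\<close>

type_synonym cpoly = "(nat \<Rightarrow>\<^sub>0 nat) \<Rightarrow>\<^sub>0 complex"

definition indet :: "nat \<Rightarrow> cpoly" where
  "indet i = Poly_Mapping.single (Poly_Mapping.single i 1) 1"

definition poly_vars :: "cpoly \<Rightarrow> nat set" where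
  "poly_vars P = (\<Union>t\<in>Poly_Mapping.keys P. Poly_Mapping.keys t)"

definition poly_eval :: "(nat \<Rightarrow> complex) \<Rightarrow> cpoly \<Rightarrow> complex" where
  "poly_eval a P = (\<Sum>t\<in>Poly_Mapping.keys P. Poly_Mapping.lookup P t *
     (\<Prod>i\<in>Poly_Mapping.keys t. a i ^ Poly_Mapping.lookup t i))"

text \<open>
  The determinants are defined over an arbitrary commutative ring, so that they can be formed
  both from complex numbers and from the indeterminates of the polynomial ring. Matrix indices
  start at 0 here; a Toeplitz matrix depends only on the difference of its indices. The determinant of the
  empty matrix is 1.
\<close>

definition toeplitz_det :: "(int \<Rightarrow> 'a::comm_ring_1) \<Rightarrow> nat \<Rightarrow> 'a" where
  "toeplitz_det a n = det (mat n n (\<lambda>(i, j). a (int j - int i)))"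

definition hankel_det :: "(nat \<Rightarrow> 'a::comm_ring_1) \<Rightarrow> nat \<Rightarrow> 'a" where
  "hankel_det u d = det (mat d d (\<lambda>(i, j). u (i + j)))"

text \<open>
  A parameter point is a function on \<open>nat\<close> of which only the values at \<open>0, \<dots>, m\<close> (symmetric
  class) or \<open>1, \<dots>, m\<close> (skew-symmetric class) are used.
\<close>

definition sym_coeff :: "nat \<Rightarrow> (nat \<Rightarrow> 'a::comm_ring_1) \<Rightarrow> int \<Rightarrow> 'a" where
  "sym_coeff m a s = (if \<bar>s\<bar> \<le> int m then a (nat \<bar>s\<bar>) else 0)"

definition skew_coeff :: "nat \<Rightarrow> (nat \<Rightarrow> 'a::comm_ring_1) \<Rightarrow> int \<Rightarrow> 'a" where
  "skew_coeff m a s =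
     (if 1 \<le> s \<and> s \<le> int m then a (nat s)
      else if 1 \<le> - s \<and> - s \<le> int m then - a (nat (- s))
      else 0)"

definition sym_D :: "nat \<Rightarrow> (nat \<Rightarrow> 'a::comm_ring_1) \<Rightarrow> nat \<Rightarrow> 'a" where
  "sym_D m a = toeplitz_det (sym_coeff m a)"

definition skew_D :: "nat \<Rightarrow> (nat \<Rightarrow> 'a::comm_ring_1) \<Rightarrow> nat \<Rightarrow> 'a" where
  "skew_D m a = toeplitz_det (skew_coeff m a)"

definition sym_H :: "nat \<Rightarrow> (nat \<Rightarrow> 'a::comm_ring_1) \<Rightarrow> 'a" where
  "sym_H m a = hankel_det (sym_D m a) ((3 ^ m + 1) div 2)"

definition skew_H :: "nat \<Rightarrow> (nat \<Rightarrow> 'a::comm_ring_1) \<Rightarrow> 'a" where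
  "skew_H m a = hankel_det (skew_D m a) (2 * 3 ^ (m - 1))"

definition satisfies_recurrence :: "(nat \<Rightarrow> complex) \<Rightarrow> nat \<Rightarrow> bool" where
  "satisfies_recurrence u d \<longleftrightarrow>
     (\<exists>c :: nat \<Rightarrow> complex. \<forall>n. u (n + d) + (\<Sum>i = 1..d. c i * u (n + d - i)) = 0)"

text \<open>
  A relation rather than a \<open>LEAST\<close> term, so that it includes the existence of a recurrence.
\<close>

definition min_recurrence_degree :: "(nat \<Rightarrow> complex) \<Rightarrow> nat \<Rightarrow> bool" where
  "min_recurrence_degree u d \<longleftrightarrow>
     satisfies_recurrence u d \<and> (\<forall>d'. satisfies_recurrence u d' \<longrightarrow> d \<le> d')"

end

theory Submission
  imports Defs "HOL-Computational_Algebra.Fundamental_Theorem_Algebra"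
begin

text \<open>
  If the symbol \<open>z\<^sup>m \<Sum> a\<^sub>s z\<^sup>s\<close> has \<open>2m\<close> distinct roots \<open>x\<^sub>i\<close>, then \<open>D\<^sub>n\<close> is a linear combination of
  the exponentials \<open>(\<plusminus>a\<^sub>m \<Prod>\<^sub>i\<^sub>\<in>\<^sub>M x\<^sub>i)\<^sup>n\<close> over the \<open>m\<close>-element sets \<open>M\<close>. In both classes the roots
  come in inverse pairs \<open>r\<^sub>j\<close>, \<open>1/r\<^sub>j\<close> (besides \<open>\<plusminus>1\<close> in the skew-symmetric class), so the base of the
  exponential depends only on the exponents in \<open>{-1, 0, 1}\<close> with which the \<open>r\<^sub>j\<close> occur (and on a sign);
  read as ternary digits, these take exactly \<open>d\<close> values. Hence all minors of order \<open>d + 1\<close> of the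
  Hankel matrix vanish at generic points, by continuity everywhere, and expanding such a minor along
  a row gives the recurrence wherever \<open>H \<noteq> 0\<close>.

  At the real point \<open>r\<^sub>j = 2^3^j\<close> the \<open>d\<close> bases are distinct. The coefficient of the exponential of \<open>M\<close>
  has, up to a factor depending on the product only, the sign \<open>(-1)\<close> to the sum of the positions of \<open>M\<close>
  in the increasing order of the roots. Exchanging a full pair for another one does not change this
  sum, so contributions with the same base do not cancel, and \<open>H \<noteq> 0\<close> follows by writing the Hankel
  matrix as a product of two Vandermonde matrices and an invertible diagonal matrix.
\<close>

section \<open>Toeplitz determinants as exponential sums\<close>

lemma det_mat_lower_left_zero:
  fixes f :: "nat \<times> nat \<Rightarrow> 'a::idom"
  assumes "\<And>i j. p \<le> i \<Longrightarrow> i < p + q \<Longrightarrow> j < p \<Longrightarrow> f (i, j) = 0"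
  shows "det (mat (p + q) (p + q) f) = det (mat p p f) * det (mat q q (\<lambda>(i, j). f (p + i, p + j)))"
proof -
  have "mat (p + q) (p + q) f = four_block_mat (mat p p f) (mat p q (\<lambda>(i, j). f (i, p + j)))
    (0\<^sub>m q p) (mat q q (\<lambda>(i, j). f (p + i, p + j)))"
    by (rule eq_matI) (use assms in auto)
  then show ?thesis
    by (simp add: det_four_block_mat_lower_left_zero[of _ p _ q])
qed

lemma det_mat_upper_right_zero:
  fixes f :: "nat \<times> nat \<Rightarrow> 'a::idom"
  assumes "\<And>i j. i < p \<Longrightarrow> p \<le> j \<Longrightarrow> j < p + q \<Longrightarrow> f (i, j) = 0"
  shows "det (mat (p + q) (p + q) f) = det (mat p p f) * det (mat q q (\<lambda>(i, j). f (p + i, p + j)))"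
proof -
  have "mat (p + q) (p + q) f = four_block_mat (mat p p f) (0\<^sub>m p q)
    (mat q p (\<lambda>(i, j). f (p + i, j))) (mat q q (\<lambda>(i, j). f (p + i, p + j)))"
    by (rule eq_matI) (use assms in auto)
  then show ?thesis
    by (simp add: det_four_block_mat_upper_right_zero[of _ p _ q])
qed

lemma poly_eq_sum_lessThan:
  fixes p :: "'a::comm_semiring_1 poly"
  assumes "degree p < n"
  shows "poly p x = (\<Sum>j<n. coeff p j * x ^ j)"
proof -
  have "(\<Sum>j<n. coeff p j * x ^ j) = (\<Sum>j\<le>degree p. coeff p j * x ^ j)"
    by (rule sum.mono_neutral_right) (use assms in \<open>auto simp: coeff_eq_0\<close>)
  then show ?thesis by (simp add: poly_altdef)
qed

text \<open>Row operations replace the monomials by the Newton polynomials of the nodes, which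
  makes the matrix triangular.\<close>
lemma det_vandermonde:
  fixes x :: "nat \<Rightarrow> 'a::idom"
  shows "det (mat n n (\<lambda>(k, i). x i ^ k)) = (\<Prod>i<n. \<Prod>l<i. x i - x l)"
proof -
  define N where "N k = (\<Prod>l<k. [:- x l, 1:])" for k
  have deg: "degree (N k) = k" for k
    unfolding N_def by (subst degree_prod_eq_sum_degree) auto
  have lead: "coeff (N k) k = 1" for k
    using lead_coeff_prod[of "\<lambda>l. [:- x l, 1:]" "{..<k}"] deg[of k] by (simp add: N_def)
  have ev: "poly (N k) z = (\<Prod>l<k. z - x l)" for k z
    by (simp add: N_def poly_prod)
  let ?V = "mat n n (\<lambda>(k, i). x i ^ k)"
  let ?T = "mat n n (\<lambda>(k, j). coeff (N k) j)"
  let ?U = "mat n n (\<lambda>(k, i). poly (N k) (x i))"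
  have "?T * ?V = ?U"
  proof (rule eq_matI)
    fix k i assume "k < dim_row ?U" "i < dim_col ?U"
    then show "(?T * ?V) $$ (k, i) = ?U $$ (k, i)"
      using deg[of k] by (simp add: poly_eq_sum_lessThan[of _ n] scalar_prod_def atLeast0LessThan)
  qed auto
  then have "det ?T * det ?V = det ?U"
    by (metis det_mult mat_carrier)
  moreover have "det ?T = 1"
    by (subst det_lower_triangular[of n])
      (auto simp: deg coeff_eq_0 prod_list_diag_prod lead)
  moreover have "det ?U = (\<Prod>i<n. \<Prod>l<i. x i - x l)"
  proof (subst det_upper_triangular[of _ n])
    show "upper_triangular ?U"
      by (auto simp: upper_triangular_def ev)
  qed (auto simp: ev prod_list_diag_prod atLeast0LessThan)
  ultimately show ?thesis by simp
qed

text \<open>These are the coefficients of the Laurent polynomial f(z) / z^m. The guard is needed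
  because \<open>nat\<close> sends every index below \<open>- int m\<close> to 0, where
  \<open>coeff f 0\<close> would be read off.\<close>

definition band_coeff :: "nat \<Rightarrow> 'a::zero poly \<Rightarrow> int \<Rightarrow> 'a" where
  "band_coeff m f s = (if - int m \<le> s then coeff f (nat (s + int m)) else 0)"

text \<open>The banded matrix of all shifts of \<open>f\<close> annihilates the Vandermonde matrix of its roots; bordered
  by \<open>2m\<close> unit rows it becomes square, and its product with the Vandermonde matrix bordered by unit
  columns is block triangular. The permutation \<open>\<rho>\<close> lists the \<open>m\<close> first, then the \<open>m\<close> last indices.\<close>
lemma toeplitz_det_mult_vandermonde:
  fixes f :: "'a::idom poly" and x :: "nat \<Rightarrow> 'a"
  assumes deg: "degree f \<le> 2 * m" and roots: "\<And>i. i < 2 * m \<Longrightarrow> poly f (x i) = 0"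
  shows "toeplitz_det (band_coeff m f) n * det (mat (2 * m) (2 * m) (\<lambda>(k, i). x i ^ k)) =
    ((-1) ^ m * coeff f (2 * m)) ^ n *
    det (mat (2 * m) (2 * m) (\<lambda>(k, i). x i ^ (if k < m then k else k + n)))"
proof -
  define N where "N = 2 * m + n"
  define \<rho> where "\<rho> k = (if k < m then k else if k < m + m then k + n else k - m)" for k
  define b where "b r k = (if r \<le> k then coeff f (k - r) else 0)" for r k
  define q where "q = (\<lambda>(k, l). if l < 2 * m then x l ^ k else if k = l then 1 else 0)"
  define Q' where "Q' = mat N N (\<lambda>(k, l). q (\<rho> k, l))"
  define p where "p = (\<lambda>(i, k). if i < 2 * m then if k = i then 1 else 0 else b (i - 2 * m) (\<rho> k))"
  define L where "L = (\<lambda>(i, l). if i < 2 * m then q (\<rho> i, l) else if l < 2 * m then 0 else b (i - 2 * m) l)"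
  have \<rho>_bij: "bij_betw \<rho> {..<N} {..<N}"
    unfolding \<rho>_def N_def
    by (rule bij_betw_byWitness[where f' = "\<lambda>k. if k < m then k else if k < m + n then k + m else k - n"]) auto
  have detQ: "det (mat N N q) = det (mat (2 * m) (2 * m) (\<lambda>(k, i). x i ^ k))"
  proof -
    have "det (mat N N q) = det (mat (2 * m) (2 * m) q) * det (mat n n (\<lambda>(i, j). q (2 * m + i, 2 * m + j)))"
      unfolding N_def by (rule det_mat_upper_right_zero) (auto simp: q_def)
    moreover have "mat n n (\<lambda>(i, j). q (2 * m + i, 2 * m + j)) = 1\<^sub>m n"
      by (rule eq_matI) (auto simp: q_def)
    moreover have "mat (2 * m) (2 * m) q = mat (2 * m) (2 * m) (\<lambda>(k, i). x i ^ k)"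
      by (rule eq_matI) (auto simp: q_def)
    ultimately show ?thesis by simp
  qed
  \<comment> \<open>Moving the last m rows above the n rows before them costs nm adjacent
    transpositions; this sign becomes the factor \<open>(-1) ^ m\<close> in the base of the
    exponentials.\<close>
  have detQ': "det (mat N N q) = (-1) ^ (n * m) * det Q'"
  proof -
    have "N = m + n + m" by (simp add: N_def)
    note det_swap_final_rows[OF mat_carrier this, of q]
    also have "mat N N (\<lambda>(i, j). mat N N q $$ (if i < m then i else if i < m + m then i + n else i - m, j)) = Q'"
      by (rule eq_matI) (auto simp: Q'_def \<rho>_def N_def)
    finally show ?thesis .
  qed
  \<comment> \<open>From column 2m on, \<open>\<rho>\<close> subtracts m, so the lower right block
    has the entries \<open>coeff f (m + j - i)\<close> of the Toeplitz matrix.\<close>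
  have detP: "det (mat N N p) = toeplitz_det (band_coeff m f) n"
  proof -
    have "det (mat N N p) = det (mat (2 * m) (2 * m) p) * det (mat n n (\<lambda>(i, j). p (2 * m + i, 2 * m + j)))"
      unfolding N_def by (rule det_mat_upper_right_zero) (auto simp: p_def)
    moreover have "mat (2 * m) (2 * m) p = 1\<^sub>m (2 * m)"
      by (rule eq_matI) (auto simp: p_def)
    moreover have "mat n n (\<lambda>(i, j). p (2 * m + i, 2 * m + j)) =
        mat n n (\<lambda>(i, j). band_coeff m f (int j - int i))"
      by (rule eq_matI) (auto simp: p_def b_def \<rho>_def band_coeff_def nat_eq_iff intro!: arg_cong[of _ _ "coeff f"])
    ultimately show ?thesis by (simp add: toeplitz_det_def)
  qed
  have row: "(\<Sum>k<N. b r k * x l ^ k) = 0" if "l < 2 * m" "r < n" for r l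
  proof -
    have "(\<Sum>k<N. b r k * x l ^ k) = (\<Sum>k\<in>{r..<N}. b r k * x l ^ k)"
      by (rule sum.mono_neutral_right) (auto simp: b_def)
    also have "\<dots> = (\<Sum>k<N - r. b r (k + r) * x l ^ (k + r))"
      by (rule sum.reindex_bij_witness[of _ "\<lambda>k. k + r" "\<lambda>k. k - r"]) auto
    also have "\<dots> = x l ^ r * (\<Sum>k<N - r. coeff f k * x l ^ k)"
      by (simp add: b_def sum_distrib_left power_add mult_ac)
    also have "(\<Sum>k<N - r. coeff f k * x l ^ k) = poly f (x l)"
      by (rule poly_eq_sum_lessThan[symmetric]) (use deg that in \<open>simp add: N_def\<close>)
    finally show ?thesis using roots that by simp
  qed
  have "mat N N p * Q' = mat N N L"
  proof (rule eq_matI)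
    fix i l assume "i < dim_row (mat N N L)" "l < dim_col (mat N N L)"
    then have i: "i < N" and l: "l < N" by auto
    have "(mat N N p * Q') $$ (i, l) = (\<Sum>k<N. p (i, k) * q (\<rho> k, l))"
      using i l by (simp add: Q'_def scalar_prod_def atLeast0LessThan)
    also have "\<dots> = L (i, l)"
    proof (cases "i < 2 * m")
      case True
      then have "(\<Sum>k<N. p (i, k) * q (\<rho> k, l)) = (\<Sum>k<N. if k = i then q (\<rho> k, l) else 0)"
        by (intro sum.cong) (auto simp: p_def)
      also have "\<dots> = q (\<rho> i, l)" using i by simp
      finally show ?thesis using True by (simp add: L_def)
    next
      case False
      then have "(\<Sum>k<N. p (i, k) * q (\<rho> k, l)) = (\<Sum>k<N. b (i - 2 * m) (\<rho> k) * q (\<rho> k, l))"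
        by (simp add: p_def)
      also have "\<dots> = (\<Sum>k<N. b (i - 2 * m) k * q (k, l))"
        by (rule sum.reindex_bij_betw[OF \<rho>_bij])
      also have "\<dots> = L (i, l)"
      proof (cases "l < 2 * m")
        case True
        then show ?thesis using row[of l "i - 2 * m"] False i by (simp add: q_def L_def N_def)
      next
        case l': False
        then have "(\<Sum>k<N. b (i - 2 * m) k * q (k, l)) = (\<Sum>k<N. if k = l then b (i - 2 * m) l else 0)"
          by (intro sum.cong) (auto simp: q_def)
        also have "\<dots> = b (i - 2 * m) l" using l by simp
        finally show ?thesis using False l' by (simp add: L_def)
      qed
      finally show ?thesis .
    qed
    finally show "(mat N N p * Q') $$ (i, l) = mat N N L $$ (i, l)" using i l by simp
  qed (auto simp: Q'_def)
  then have "det (mat N N p) * det Q' = det (mat N N L)"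
    by (metis Q'_def det_mult mat_carrier)
  moreover have "det (mat N N L) = det (mat (2 * m) (2 * m) (\<lambda>(k, i). x i ^ (if k < m then k else k + n))) * coeff f (2 * m) ^ n"
  proof -
    have "det (mat N N L) = det (mat (2 * m) (2 * m) L) * det (mat n n (\<lambda>(i, j). L (2 * m + i, 2 * m + j)))"
      unfolding N_def by (rule det_mat_lower_left_zero) (auto simp: L_def)
    moreover have "mat (2 * m) (2 * m) L = mat (2 * m) (2 * m) (\<lambda>(k, i). x i ^ (if k < m then k else k + n))"
      by (rule eq_matI) (auto simp: L_def q_def \<rho>_def)
    moreover have "det (mat n n (\<lambda>(i, j). L (2 * m + i, 2 * m + j))) = coeff f (2 * m) ^ n"
      by (subst det_lower_triangular[of n])
        (use deg in \<open>auto simp: L_def b_def prod_list_diag_prod coeff_eq_0\<close>)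
    ultimately show ?thesis by simp
  qed
  moreover have sq: "(-1) ^ (n * m) * (-1) ^ (n * m) = (1::'a)"
    by (metis mult_minus1 power_mult_distrib power_one minus_minus)
  then have "det Q' = (-1) ^ (n * m) * det (mat (2 * m) (2 * m) (\<lambda>(k, i). x i ^ k))"
    unfolding detQ[symmetric] detQ' mult.assoc[symmetric] by simp
  ultimately have "(-1) ^ (n * m) * (toeplitz_det (band_coeff m f) n * det (mat (2 * m) (2 * m) (\<lambda>(k, i). x i ^ k))) =
      coeff f (2 * m) ^ n * det (mat (2 * m) (2 * m) (\<lambda>(k, i). x i ^ (if k < m then k else k + n)))"
    by (simp only: detP mult_ac)
  then have "(-1) ^ (n * m) * (-1) ^ (n * m) * (toeplitz_det (band_coeff m f) n * det (mat (2 * m) (2 * m) (\<lambda>(k, i). x i ^ k))) =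
      (-1) ^ (n * m) * (coeff f (2 * m) ^ n * det (mat (2 * m) (2 * m) (\<lambda>(k, i). x i ^ (if k < m then k else k + n))))"
    by (simp only: mult.assoc)
  then have "toeplitz_det (band_coeff m f) n * det (mat (2 * m) (2 * m) (\<lambda>(k, i). x i ^ k)) =
      (-1) ^ (n * m) * (coeff f (2 * m) ^ n * det (mat (2 * m) (2 * m) (\<lambda>(k, i). x i ^ (if k < m then k else k + n))))"
    by (simp only: sq mult_1_left)
  moreover have "(-1) ^ (n * m) = (((-1) ^ m) ^ n :: 'a)"
    by (metis mult.commute power_mult)
  ultimately show ?thesis
    by (simp only: power_mult_distrib mult.assoc)
qed

section \<open>Laplace expansion of the stretched Vandermonde determinant\<close>

lemma permutes_less_iff: "p permutes {0..<N} \<Longrightarrow> p i < N \<longleftrightarrow> i < N" for N :: nat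
  using permutes_in_image[of p "{0..<N}" i] by simp

text \<open>Group the Leibniz expansion by the set M of columns whose selected row satisfies P. The
  factors \<open>y i\<close> with i in M come out, and the zeros in the matrix belonging to M keep
  exactly the permutations of that group.\<close>

lemma det_col_selection_sum:
  fixes c :: "nat \<Rightarrow> nat \<Rightarrow> 'a::comm_ring_1"
  shows "det (mat N N (\<lambda>(k, i). (if P k then y i else 1) * c k i)) =
    (\<Sum>M\<in>Pow {..<N}. (\<Prod>i\<in>M. y i) * det (mat N N (\<lambda>(k, i). if P k = (i \<in> M) then c k i else 0)))"
proof -
  let ?S = "{p. p permutes {0..<N}}"
  have L: "(\<Prod>i<N. (if P (p i) then y i else 1) * c (p i) i) =
      (\<Prod>i\<in>{i\<in>{..<N}. P (p i)}. y i) * (\<Prod>i<N. c (p i) i)" for p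
    by (subst prod.inter_filter) (auto simp: prod.distrib)
  have R: "(\<Prod>i<N. if P (p i) = (i \<in> M) then c (p i) i else 0) =
      (if M = {i\<in>{..<N}. P (p i)} then \<Prod>i<N. c (p i) i else 0)" if M: "M \<in> Pow {..<N}" for p M
  proof (cases "M = {i\<in>{..<N}. P (p i)}")
    case False
    then obtain i where "i < N" "P (p i) \<noteq> (i \<in> M)" using M by blast
    then have "(\<Prod>i<N. if P (p i) = (i \<in> M) then c (p i) i else 0) = 0"
      by (intro prod_zero) auto
    then show ?thesis using False by simp
  qed auto
  have ex: "det (mat N N f) = (\<Sum>p\<in>?S. signof p * (\<Prod>i<N. f (p i, i)))" for f :: "_ \<Rightarrow> 'a"
    by (subst det_col[of _ N]) (auto simp: atLeast0LessThan permutes_less_iff intro!: sum.cong prod.cong)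
  have "(\<Sum>M\<in>Pow {..<N}. (\<Prod>i\<in>M. y i) * det (mat N N (\<lambda>(k, i). if P k = (i \<in> M) then c k i else 0))) =
      (\<Sum>M\<in>Pow {..<N}. \<Sum>p\<in>?S. signof p * ((\<Prod>i\<in>M. y i) * (if M = {i\<in>{..<N}. P (p i)} then \<Prod>i<N. c (p i) i else 0)))"
    by (intro sum.cong) (auto simp: ex R sum_distrib_left mult_ac)
  also have "\<dots> = (\<Sum>p\<in>?S. \<Sum>M\<in>Pow {..<N}. if M = {i\<in>{..<N}. P (p i)} then
        signof p * ((\<Prod>i\<in>M. y i) * (\<Prod>i<N. c (p i) i)) else 0)"
    by (subst sum.swap) (intro sum.cong, auto)
  also have "\<dots> = (\<Sum>p\<in>?S. signof p * ((\<Prod>i\<in>{i\<in>{..<N}. P (p i)}. y i) * (\<Prod>i<N. c (p i) i)))"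
    by (intro sum.cong refl) (subst sum.delta, auto)
  finally show ?thesis by (simp add: ex L)
qed

text \<open>A permutation with nonzero product maps M bijectively onto the set of rows satisfying
  P.\<close>

lemma det_col_selection_eq_0:
  fixes c :: "nat \<Rightarrow> nat \<Rightarrow> 'a::comm_ring_1"
  assumes M: "M \<subseteq> {..<N}" and card: "card M \<noteq> card {k\<in>{..<N}. P k}"
  shows "det (mat N N (\<lambda>(k, i). if P k = (i \<in> M) then c k i else 0)) = 0"
proof -
  have "(\<Prod>i<N. if P (p i) = (i \<in> M) then c (p i) i else 0) = 0" if p: "p permutes {0..<N}" for p
  proof (rule ccontr)
    assume "\<not> ?thesis"
    then have sel: "P (p i) = (i \<in> M)" if "i < N" for i
      using that prod_zero[of "{..<N}" "\<lambda>i. if P (p i) = (i \<in> M) then c (p i) i else 0"] by force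
    have "p ` M = {k\<in>{..<N}. P k}"
    proof (intro equalityI subsetI)
      fix k assume k: "k \<in> {k\<in>{..<N}. P k}"
      then have "Hilbert_Choice.inv p k < N" "p (Hilbert_Choice.inv p k) = k"
        using p permutes_less_iff[OF permutes_inv[OF p]] by (auto simp: permutes_inverses)
      then show "k \<in> p ` M" using sel k by (metis (no_types, lifting) image_eqI mem_Collect_eq)
    qed (use M sel p in \<open>auto simp: permutes_less_iff\<close>)
    then have "card M = card {k\<in>{..<N}. P k}"
      using card_image[OF inj_on_subset[OF permutes_inj[OF p] subset_UNIV], of M] by simp
    with card show False by simp
  qed
  then show ?thesis
    by (subst det_col[of _ N])
      (auto simp: atLeast0LessThan permutes_less_iff intro!: sum.neutral)
qed

text \<open>If M has N - p elements, this is up to sign a product of complementary Vandermonde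
  minors: the rows from p on with the columns in M, the rows below p with the others. Keeping both
  in one matrix avoids indexing minors by sets.\<close>

definition split_vandermonde :: "nat \<Rightarrow> nat \<Rightarrow> (nat \<Rightarrow> 'a::comm_ring_1) \<Rightarrow> nat set \<Rightarrow> 'a" where
  "split_vandermonde p N x M = det (mat N N (\<lambda>(k, i). if (p \<le> k) = (i \<in> M) then x i ^ k else 0))"

text \<open>Widom's formula with the denominator cleared. The m lower rows of the stretched
  Vandermonde matrix carry the factors \<open>x i ^ n\<close>; column selection extracts them, and
  only sets of m columns survive.\<close>

lemma toeplitz_det_exponential_sum:
  fixes f :: "'a::idom poly" and x :: "nat \<Rightarrow> 'a" and m n :: nat
  assumes deg: "degree f \<le> 2 * m" and roots: "\<And>i. i < 2 * m \<Longrightarrow> poly f (x i) = 0"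
  shows "toeplitz_det (band_coeff m f) n * (\<Prod>i<2 * m. \<Prod>l<i. x i - x l) =
    (\<Sum>M | M \<subseteq> {..<2 * m} \<and> card M = m. split_vandermonde m (2 * m) x M *
       ((-1) ^ m * coeff f (2 * m) * (\<Prod>i\<in>M. x i)) ^ n)"
proof -
  let ?c = "(-1) ^ m * coeff f (2 * m)"
  have "mat (2 * m) (2 * m) (\<lambda>(k, i). x i ^ (if k < m then k else k + n)) =
      mat (2 * m) (2 * m) (\<lambda>(k, i). (if m \<le> k then x i ^ n else 1) * x i ^ k)"
    by (rule eq_matI) (auto simp: power_add)
  then have "toeplitz_det (band_coeff m f) n * (\<Prod>i<2 * m. \<Prod>l<i. x i - x l) =
      ?c ^ n * (\<Sum>M\<in>Pow {..<2 * m}. (\<Prod>i\<in>M. x i ^ n) * split_vandermonde m (2 * m) x M)"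
    using toeplitz_det_mult_vandermonde[OF deg roots, where n = n]
    by (simp add: det_vandermonde det_col_selection_sum split_vandermonde_def)
  also have "(\<Sum>M\<in>Pow {..<2 * m}. (\<Prod>i\<in>M. x i ^ n) * split_vandermonde m (2 * m) x M) =
      (\<Sum>M | M \<subseteq> {..<2 * m} \<and> card M = m. (\<Prod>i\<in>M. x i ^ n) * split_vandermonde m (2 * m) x M)"
  proof (rule sum.mono_neutral_right)
    have "{k\<in>{..<2 * m}. m \<le> k} = {m..<2 * m}" by auto
    then show "\<forall>M\<in>Pow {..<2 * m} - {M. M \<subseteq> {..<2 * m} \<and> card M = m}.
        (\<Prod>i\<in>M. x i ^ n) * split_vandermonde m (2 * m) x M = 0"
      unfolding split_vandermonde_def
      by (intro ballI, subst det_col_selection_eq_0) auto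
  qed auto
  also have "?c ^ n * \<dots> = (\<Sum>M | M \<subseteq> {..<2 * m} \<and> card M = m. split_vandermonde m (2 * m) x M *
       (?c * (\<Prod>i\<in>M. x i)) ^ n)"
    by (simp add: sum_distrib_left power_mult_distrib prod_power_distrib mult_ac)
  finally show ?thesis .
qed

text \<open>Exchanging adjacent positions \<open>i \<in> M\<close> and \<open>i + 1 \<notin> M\<close> swaps two columns and raises \<open>\<Sum>M\<close> by one;
  when no exchange is left, \<open>M\<close> is the final segment and the matrix is block diagonal.\<close>
lemma split_vandermonde_sign:
  fixes x :: "nat \<Rightarrow> real"
  assumes "M \<subseteq> {..<p + q}" "card M = q"
    and "strict_mono_on M x" "strict_mono_on ({..<p + q} - M) x"
  shows "\<exists>r>0. split_vandermonde p (p + q) x M =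
    (-1) ^ (\<Sum>M + \<Sum>{p..<p + q}) * (\<Prod>i\<in>M. x i) ^ p * r"
  using assms
\<comment> \<open>Replacing i by i + 1 in M lowers this measure by one.\<close>
proof (induction "\<Sum>i\<in>M. p + q - i" arbitrary: M x rule: less_induct)
  case (less M x)
  note sub = less.prems(1) and card = less.prems(2) and mono = less.prems(3,4)
  have fin: "finite M" using sub finite_subset by blast
  show ?case
  proof (cases "\<exists>i\<in>M. Suc i < p + q \<and> Suc i \<notin> M")
    case False
    have up: "j \<in> M" if "i \<in> M" "i \<le> j" "j < p + q" for i j
      using that(2,3) by (induction j rule: dec_induct) (use that(1) False in auto)
    have M: "M = {p..<p + q}"
    proof (cases "M = {}")
      case True then show ?thesis using card by simp
    next
      case ne: False
      have "M = {Min M..<p + q}"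
        using up[OF Min_in[OF fin ne]] Min_le[OF fin] sub by auto
      moreover from this have "card M = p + q - Min M" by (metis card_atLeastLessThan)
      moreover have "Min M < p + q" using Min_in[OF fin ne] sub by auto
      ultimately show ?thesis using card by (metis add_diff_cancel_right' diff_diff_cancel less_imp_le)
    qed
    have block: "split_vandermonde p (p + q) x M =
        det (mat p p (\<lambda>(k, i). x i ^ k)) * det (mat q q (\<lambda>(k, i). x (p + i) ^ (p + k)))"
    proof -
      have "mat p p (\<lambda>(k, i). if (p \<le> k) = (i \<in> M) then x i ^ k else 0) = mat p p (\<lambda>(k, i). x i ^ k)"
        by (rule eq_matI) (auto simp: M)
      moreover have "mat q q (\<lambda>(k, i). case (p + k, p + i) of (k, i) \<Rightarrow> if (p \<le> k) = (i \<in> M) then x i ^ k else 0)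
          = mat q q (\<lambda>(k, i). x (p + i) ^ (p + k))"
        by (rule eq_matI) (auto simp: M)
      ultimately show ?thesis
        unfolding split_vandermonde_def by (subst det_mat_lower_left_zero) (auto simp: M)
    qed
    have scale: "det (mat q q (\<lambda>(k, i). x (p + i) ^ (p + k))) =
        det (mat q q (\<lambda>(k, i). x (p + i) ^ k)) * (\<Prod>i\<in>M. x i) ^ p"
    proof -
      let ?D = "mat q q (\<lambda>(k, i). if k = i then x (p + i) ^ p else 0)"
      have "mat q q (\<lambda>(k, i). x (p + i) ^ (p + k)) = mat q q (\<lambda>(k, i). x (p + i) ^ k) * ?D"
        by (rule eq_matI)
          (auto simp: scalar_prod_def power_add if_distrib[of "(*) _"] mult.commute cong: if_cong)
      moreover have "det ?D = (\<Prod>i<q. x (p + i)) ^ p"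
        by (subst det_upper_triangular[of _ q])
          (auto simp: prod_list_diag_prod atLeast0LessThan prod_power_distrib)
      moreover have "(\<Prod>i<q. x (p + i)) = (\<Prod>i\<in>M. x i)"
        unfolding M by (rule prod.reindex_bij_witness[of _ "\<lambda>i. i - p" "\<lambda>i. p + i"]) auto
      ultimately show ?thesis
        using det_mult[of "mat q q (\<lambda>(k, i). x (p + i) ^ k)" q ?D] by simp
    qed
    \<comment> \<open>For the final segment the two sums in the exponent agree, so the sign is
      +1.\<close>
    have sgn: "(-1) ^ \<Sum>{p..<p + q} * (-1) ^ \<Sum>{p..<p + q} = (1::real)"
      by (metis mult_minus1 power_mult_distrib power_one minus_minus)
    have "0 < (\<Prod>i<p. \<Prod>l<i. x i - x l)"
      using mono(2) by (intro prod_pos) (auto simp: M strict_mono_on_def)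
    moreover have "0 < (\<Prod>i<q. \<Prod>l<i. x (p + i) - x (p + l))"
      using mono(1) by (intro prod_pos) (auto simp: M strict_mono_on_def)
    moreover have "split_vandermonde p (p + q) x M = (-1) ^ (\<Sum>M + \<Sum>{p..<p + q}) * (\<Prod>i\<in>M. x i) ^ p *
        ((\<Prod>i<p. \<Prod>l<i. x i - x l) * (\<Prod>i<q. \<Prod>l<i. x (p + i) - x (p + l)))"
      using det_vandermonde[of p x] det_vandermonde[of q "\<lambda>i. x (p + i)"]
      unfolding block scale using M sgn by (simp add: power_add)
    ultimately show ?thesis using mult_pos_pos by blast
  next
    case True
    then obtain i where i: "i \<in> M" "Suc i < p + q" "Suc i \<notin> M" by blast
    define M' where "M' = insert (Suc i) (M - {i})"
    \<comment> \<open>The nodes move along with the columns. Read in increasing order of positions,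
      M' and its complement carry the same nodes as M and its complement, so monotonicity on each of
      the two sets persists, although the whole sequence need not stay monotone.\<close>
    define x' where "x' = x(i := x (Suc i), Suc i := x i)"
    have sub': "M' \<subseteq> {..<p + q}" using sub i by (auto simp: M'_def)
    have fin': "finite (M - {i})" using fin by simp
    have M_eq: "M = insert i (M - {i})" using i by auto
    have notin: "Suc i \<notin> M - {i}" "i \<notin> M - {i}" using i by auto
    have card': "card M' = q"
      using card M_eq fin' notin by (metis M'_def card_insert_disjoint)
    have sum': "\<Sum>M' = Suc (\<Sum>M)"
      using sum.insert[OF fin' notin(1), of "\<lambda>i. i"] sum.insert[OF fin' notin(2), of "\<lambda>i. i"] M_eq
      by (simp add: M'_def)
    have prod': "(\<Prod>i\<in>M'. x' i) = (\<Prod>i\<in>M. x i)"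
    proof -
      have "(\<Prod>i\<in>M'. x' i) = x i * (\<Prod>j\<in>M - {i}. x' j)"
        unfolding M'_def by (subst prod.insert[OF fin' notin(1)]) (simp add: x'_def)
      also have "(\<Prod>j\<in>M - {i}. x' j) = (\<Prod>j\<in>M - {i}. x j)"
        using notin by (intro prod.cong) (auto simp: x'_def)
      finally show ?thesis using prod.remove[OF fin i(1), of x] by simp
    qed
    have mono1: "strict_mono_on M' x'"
    proof (rule strict_mono_onI)
      fix r s assume rs: "r \<in> M'" "s \<in> M'" "r < s"
      show "x' r < x' s"
      proof (cases "r = Suc i \<or> s = Suc i")
        case True
        then show ?thesis using rs mono(1) i
          by (auto simp: x'_def M'_def strict_mono_on_def less_Suc_eq)
      next
        case False
        then show ?thesis using rs mono(1) i by (auto simp: x'_def M'_def strict_mono_on_def)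
      qed
    qed
    have mono2: "strict_mono_on ({..<p + q} - M') x'"
    proof (rule strict_mono_onI)
      fix r s assume rs: "r \<in> {..<p + q} - M'" "s \<in> {..<p + q} - M'" "r < s"
      then have ne: "r \<noteq> Suc i" "s \<noteq> Suc i" by (auto simp: M'_def)
      have *: "x a < x b" if "a < b" "a \<notin> M" "b \<notin> M" "b < p + q" for a b
        using mono(2) that by (auto simp: strict_mono_on_def)
      consider "r = i" | "s = i" | "r \<noteq> i" "s \<noteq> i" by blast
      then show "x' r < x' s"
      proof cases
        case 1
        then show ?thesis using rs ne i *[of "Suc i" s] by (auto simp: x'_def M'_def)
      next
        case 2
        then show ?thesis using rs ne i *[of r "Suc i"] by (auto simp: x'_def M'_def)
      next
        case 3
        then show ?thesis using rs ne *[of r s] by (auto simp: x'_def M'_def)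
      qed
    qed
    have meas: "(\<Sum>i\<in>M'. p + q - i) < (\<Sum>i\<in>M. p + q - i)"
      using sum.insert[OF fin' notin(1), of "\<lambda>i. p + q - i"] sum.insert[OF fin' notin(2), of "\<lambda>i. p + q - i"] M_eq i
      by (simp add: M'_def)
    obtain r where r: "r > 0" "split_vandermonde p (p + q) x' M' =
        (-1) ^ (\<Sum>M' + \<Sum>{p..<p + q}) * (\<Prod>i\<in>M'. x' i) ^ p * r"
      using less.hyps[OF meas sub' card' mono1 mono2] by blast
    let ?A = "mat (p + q) (p + q) (\<lambda>(k, i). if (p \<le> k) = (i \<in> M) then x i ^ k else 0)"
    have "mat (p + q) (p + q) (\<lambda>(k, i). if (p \<le> k) = (i \<in> M') then x' i ^ k else 0) = swapcols i (Suc i) ?A"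
      by (rule eq_matI) (use i in \<open>auto simp: M'_def x'_def\<close>)
    then have "split_vandermonde p (p + q) x' M' = - split_vandermonde p (p + q) x M"
      unfolding split_vandermonde_def using det_swapcols[of i "p + q" "Suc i" ?A] i by simp
    then have "split_vandermonde p (p + q) x M =
        (-1) ^ (\<Sum>M + \<Sum>{p..<p + q}) * (\<Prod>i\<in>M. x i) ^ p * r"
      using r(2) by (simp add: sum' prod')
    with r(1) show ?thesis by blast
  qed
qed

section \<open>Hankel determinants and recurrences\<close>

text \<open>The coefficients of a polynomial vanishing at all bases form a kernel vector, whichever
  rows are chosen. The factor \<open>monom\<close> raises the degree to exactly d, so the last entry
  of the vector is nonzero.\<close>

lemma minor_exponential_sum_eq_0:
  fixes w :: "'i \<Rightarrow> 'a::field"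
  assumes fin: "finite I" and card: "card (w ` I) \<le> d"
    and u: "\<And>n. u n = (\<Sum>i\<in>I. C i * w i ^ n)"
  shows "det (mat (Suc d) (Suc d) (\<lambda>(i, j). u (p i + j))) = 0"
proof -
  define q where "q = (\<Prod>v\<in>w ` I. [:- v, 1:]) * monom 1 (d - card (w ` I))"
  have "degree (\<Prod>v\<in>w ` I. [:- v, 1:]) = card (w ` I)"
    by (subst degree_prod_eq_sum_degree) auto
  then have deg: "degree q = d"
    using card fin by (simp add: q_def degree_mult_eq degree_monom_eq monom_eq_0_iff)
  have q0: "q \<noteq> 0" using fin by (auto simp: q_def)
  have root: "poly q (w i) = 0" if "i \<in> I" for i
  proof -
    have "(\<Prod>v\<in>w ` I. w i - v) = 0"
      using that fin by (intro prod_zero) auto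
    then show ?thesis by (simp add: q_def poly_prod)
  qed
  let ?A = "mat (Suc d) (Suc d) (\<lambda>(i, j). u (p i + j))"
  let ?v = "vec (Suc d) (coeff q)"
  have "?A *\<^sub>v ?v = 0\<^sub>v (Suc d)"
  proof (rule eq_vecI)
    fix k assume "k < dim_vec (0\<^sub>v (Suc d) :: 'a vec)"
    then have "(?A *\<^sub>v ?v) $ k = (\<Sum>j<Suc d. u (p k + j) * coeff q j)"
      by (simp add: scalar_prod_def atLeast0LessThan del: sum.lessThan_Suc)
    also have "\<dots> = (\<Sum>j<Suc d. \<Sum>i\<in>I. C i * w i ^ p k * (coeff q j * w i ^ j))"
      by (simp add: u sum_distrib_right sum_distrib_left power_add mult_ac del: sum.lessThan_Suc)
    also have "\<dots> = (\<Sum>i\<in>I. C i * w i ^ p k * poly q (w i))"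
      by (subst sum.swap) (simp add: poly_eq_sum_lessThan[of q "Suc d"] deg sum_distrib_left del: sum.lessThan_Suc)
    also have "\<dots> = 0" by (simp add: root)
    finally show "(?A *\<^sub>v ?v) $ k = 0\<^sub>v (Suc d) $ k"
      using \<open>k < _\<close> by simp
  qed simp
  moreover have "?v \<noteq> 0\<^sub>v (Suc d)"
    using q0 deg by (metis index_vec index_zero_vec(1) leading_coeff_0_iff lessI)
  ultimately show ?thesis
    using det_0_iff_vec_prod_zero[of ?A "Suc d"] by (metis mat_carrier vec_carrier)
qed

lemma hankel_det_exponential_sum_neq_0:
  fixes W :: "'a::field set"
  assumes fin: "finite W" and nz: "\<And>v. v \<in> W \<Longrightarrow> C v \<noteq> 0"
    and u: "\<And>n. u n = (\<Sum>v\<in>W. C v * v ^ n)"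
  shows "hankel_det u (card W) \<noteq> 0"
proof -
  define d where "d = card W"
  obtain e where e: "bij_betw e {..<d} W"
    using ex_bij_betw_nat_finite[OF fin] by (auto simp: d_def atLeast0LessThan)
  have inj: "e i \<noteq> e l" if "l < i" "i < d" for i l
    using e that inj_onD[of e "{..<d}" i l] by (auto simp: bij_betw_def)
  let ?V = "mat d d (\<lambda>(k, i). e i ^ k)"
  let ?D = "mat d d (\<lambda>(k, i). if k = i then C (e i) else 0)"
  have "mat d d (\<lambda>(i, j). u (i + j)) = ?V * (?D * transpose_mat ?V)"
  proof (rule eq_matI)
    fix i j assume "i < dim_row (?V * (?D * transpose_mat ?V))" "j < dim_col (?V * (?D * transpose_mat ?V))"
    then have ij: "i < d" "j < d" by auto
    have "(?D * transpose_mat ?V) $$ (k, j) = C (e k) * e k ^ j" if "k < d" for k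
    proof -
      have "(?D * transpose_mat ?V) $$ (k, j) = (\<Sum>l<d. (if k = l then C (e l) else 0) * e l ^ j)"
        using that ij by (simp add: scalar_prod_def atLeast0LessThan)
      also have "\<dots> = (\<Sum>l<d. if l = k then C (e k) * e k ^ j else 0)"
        by (intro sum.cong) auto
      finally show ?thesis using that by simp
    qed
    then have "(?V * (?D * transpose_mat ?V)) $$ (i, j) = (\<Sum>k<d. e k ^ i * (C (e k) * e k ^ j))"
      using ij by (simp add: scalar_prod_def atLeast0LessThan)
    also have "\<dots> = (\<Sum>k<d. C (e k) * e k ^ (i + j))"
      by (simp add: power_add mult_ac)
    also have "\<dots> = u (i + j)"
      unfolding u by (rule sum.reindex_bij_betw[OF e])
    finally show "mat d d (\<lambda>(i, j). u (i + j)) $$ (i, j) = (?V * (?D * transpose_mat ?V)) $$ (i, j)"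
      using ij by simp
  qed auto
  moreover have "?D * transpose_mat ?V \<in> carrier_mat d d"
    by (rule mult_carrier_mat[of _ d d]) auto
  ultimately have "hankel_det u d = det ?V * (det ?D * det ?V)"
    using det_mult[of ?V d "?D * transpose_mat ?V"] det_mult[of ?D d "transpose_mat ?V"] det_transpose[of ?V d]
    by (simp add: hankel_det_def)
  moreover have "det ?V \<noteq> 0"
    unfolding det_vandermonde using inj by auto
  moreover have "det ?D = (\<Prod>i<d. C (e i))"
    by (subst det_upper_triangular[of _ d]) (auto simp: prod_list_diag_prod atLeast0LessThan)
  moreover have "(\<Prod>i<d. C (e i)) \<noteq> 0"
    using nz e by (auto simp: bij_betw_def)
  ultimately show ?thesis by (simp add: d_def)
qed

text \<open>Only the last row depends on n, so its cofactors are constants. The last of them is the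
  Hankel determinant, by which the expansion is divided to make the recurrence monic.\<close>

lemma satisfies_recurrence_if_minors_eq_0:
  assumes minors: "\<And>n. det (mat (Suc d) (Suc d) (\<lambda>(i, j). u ((if i < d then i else n) + j))) = 0"
    and H: "hankel_det u d \<noteq> 0"
  shows "satisfies_recurrence u d"
proof -
  let ?A = "\<lambda>n. mat (Suc d) (Suc d) (\<lambda>(i, j). u ((if i < d then i else n) + j))"
  define K where "K j = cofactor (?A 0) d j" for j
  have K: "cofactor (?A n) d j = K j" for n j
  proof -
    have "mat_delete (?A n) d j = mat_delete (?A 0) d j"
      by (rule eq_matI) (auto simp: mat_delete_def)
    then show ?thesis by (simp only: K_def cofactor_def)
  qed
  have "mat_delete (?A 0) d d = mat d d (\<lambda>(i, j). u (i + j))"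
    by (rule eq_matI) (auto simp: mat_delete_def)
  then have Kd: "K d = hankel_det u d"
    unfolding K_def cofactor_def hankel_det_def by (simp only: neg_one_even_power[of "d + d"] even_add simp_thms mult_1_left)
  have expand: "(\<Sum>j<Suc d. u (n + j) * K j) = 0" for n
  proof -
    have "det (?A n) = (\<Sum>j<Suc d. ?A n $$ (d, j) * cofactor (?A n) d j)"
      by (rule laplace_expansion_row) auto
    also have "\<dots> = (\<Sum>j<Suc d. u (n + j) * K j)"
      by (intro sum.cong) (auto simp: K)
    finally show ?thesis using minors by simp
  qed
  have "u (n + d) + (\<Sum>i = 1..d. K (d - i) / K d * u (n + d - i)) = 0" for n
  proof -
    have "(\<Sum>i = 1..d. K (d - i) / K d * u (n + d - i)) = (\<Sum>j<d. K j / K d * u (n + j))"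
      by (rule sum.reindex_bij_witness[of _ "\<lambda>j. d - j" "\<lambda>i. d - i"]) auto
    then have "K d * (u (n + d) + (\<Sum>i = 1..d. K (d - i) / K d * u (n + d - i))) =
        K d * u (n + d) + (\<Sum>j<d. K d * (K j / K d * u (n + j)))"
      by (simp add: distrib_left sum_distrib_left)
    also have "\<dots> = 0"
      using expand[of n] H Kd by (simp add: mult_ac add_ac)
    finally show ?thesis using H Kd by simp
  qed
  then show ?thesis unfolding satisfies_recurrence_def by (intro exI[of _ "\<lambda>i. K (d - i) / K d"] allI)
qed

text \<open>The coefficients of the shorter recurrence in reversed order, followed by 1 and padded
  with zeros, form a nonzero kernel vector of the Hankel matrix.\<close>

lemma hankel_det_eq_0_if_recurrence:
  assumes rec: "satisfies_recurrence u d'" and less: "d' < d"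
  shows "hankel_det u d = 0"
proof -
  obtain c where c: "\<And>n. u (n + d') + (\<Sum>i = 1..d'. c i * u (n + d' - i)) = 0"
    using rec unfolding satisfies_recurrence_def by blast
  let ?A = "mat d d (\<lambda>(i, j). u (i + j))"
  define k where "k j = (if j < d' then c (d' - j) else if j = d' then 1 else 0)" for j
  have "?A *\<^sub>v vec d k = 0\<^sub>v d"
  proof (rule eq_vecI)
    fix n assume n: "n < dim_vec (0\<^sub>v d :: complex vec)"
    then have "(?A *\<^sub>v vec d k) $ n = (\<Sum>j<d. u (n + j) * k j)"
      by (simp add: scalar_prod_def atLeast0LessThan)
    also have "\<dots> = (\<Sum>j<Suc d'. u (n + j) * k j)"
      using less by (intro sum.mono_neutral_right) (auto simp: k_def)
    also have "\<dots> = u (n + d') + (\<Sum>j<d'. c (d' - j) * u (n + j))"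
      by (simp add: k_def mult.commute)
    also have "(\<Sum>j<d'. c (d' - j) * u (n + j)) = (\<Sum>i = 1..d'. c i * u (n + d' - i))"
      by (rule sum.reindex_bij_witness[of _ "\<lambda>i. d' - i" "\<lambda>j. d' - j"]) auto
    finally show "(?A *\<^sub>v vec d k) $ n = 0\<^sub>v d $ n"
      using c n by simp
  qed simp
  moreover have "vec d k \<noteq> 0\<^sub>v d"
  proof
    assume "vec d k = 0\<^sub>v d"
    then have "vec d k $ d' = 0\<^sub>v d $ d'" by simp
    with less show False by (simp add: k_def)
  qed
  ultimately show ?thesis
    unfolding hankel_det_def using det_0_iff_vec_prod_zero[of ?A d] by (metis mat_carrier vec_carrier)
qed

section \<open>Continuity of determinants and compatibility with ring homomorphisms\<close>

lemma tendsto_det_mat: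
  fixes f :: "'b \<Rightarrow> nat \<times> nat \<Rightarrow> 'a::{comm_ring_1, real_normed_algebra_1}"
  assumes "\<And>i j. i < n \<Longrightarrow> j < n \<Longrightarrow> ((\<lambda>t. f t (i, j)) \<longlongrightarrow> g (i, j)) F"
  shows "((\<lambda>t. det (mat n n (f t))) \<longlongrightarrow> det (mat n n g)) F"
proof -
  have "det (mat n n h) = (\<Sum>p | p permutes {0..<n}. signof p * (\<Prod>i = 0..<n. h (i, p i)))" for h :: "_ \<Rightarrow> 'a"
    by (subst det_def'[of _ n]) (auto simp: permutes_less_iff intro!: sum.cong prod.cong)
  then show ?thesis
    by (simp only:) (intro tendsto_sum tendsto_mult tendsto_const tendsto_prod assms; simp add: permutes_less_iff)
qed

lemma tendsto_toeplitz_det: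
  fixes a :: "'b \<Rightarrow> int \<Rightarrow> 'a::{comm_ring_1, real_normed_algebra_1}"
  assumes "\<And>s. ((\<lambda>t. a t s) \<longlongrightarrow> b s) F"
  shows "((\<lambda>t. toeplitz_det (a t) n) \<longlongrightarrow> toeplitz_det b n) F"
  unfolding toeplitz_det_def by (intro tendsto_det_mat) (simp add: assms)

lemma (in comm_ring_hom) hom_det_mat: "hom (det (mat n n f)) = det (mat n n (\<lambda>ij. hom (f ij)))"
proof -
  have "map_mat hom (mat n n f) = mat n n (\<lambda>ij. hom (f ij))"
    by (rule eq_matI) auto
  then show ?thesis by (metis hom_det)
qed

lemma (in comm_ring_hom) hom_toeplitz_det: "hom (toeplitz_det a n) = toeplitz_det (\<lambda>s. hom (a s)) n"
  by (simp add: toeplitz_det_def hom_det_mat case_prod_unfold)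

lemma (in comm_ring_hom) hom_hankel_det: "hom (hankel_det u d) = hankel_det (\<lambda>n. hom (u n)) d"
  by (simp add: hankel_det_def hom_det_mat case_prod_unfold)

text \<open>Serves for two homomorphisms: evaluation of polynomials at a point, and the embedding of
  the reals, which carries a real point with nonvanishing determinant over to the complex
  numbers.\<close>

lemma (in comm_ring_hom) hom_sym_H: "hom (sym_H m a) = sym_H m (\<lambda>i. hom (a i))"
  by (simp add: sym_H_def hom_hankel_det sym_D_def[abs_def] hom_toeplitz_det sym_coeff_def[abs_def] if_distrib[of hom] cong: if_cong)

lemma (in comm_ring_hom) hom_skew_H: "hom (skew_H m a) = skew_H m (\<lambda>i. hom (a i))"
  by (simp add: skew_H_def hom_hankel_det skew_D_def[abs_def] hom_toeplitz_det skew_coeff_def[abs_def] if_distrib[of hom] hom_uminus cong: if_cong)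

section \<open>Evaluation of multivariate polynomials\<close>

definition monom_eval :: "(nat \<Rightarrow> complex) \<Rightarrow> (nat \<Rightarrow>\<^sub>0 nat) \<Rightarrow> complex" where
  "monom_eval a t = (\<Prod>i\<in>Poly_Mapping.keys t. a i ^ Poly_Mapping.lookup t i)"

lemma monom_eval_superset:
  assumes "finite A" "Poly_Mapping.keys t \<subseteq> A"
  shows "monom_eval a t = (\<Prod>i\<in>A. a i ^ Poly_Mapping.lookup t i)"
  unfolding monom_eval_def
  by (rule prod.mono_neutral_left) (use assms in \<open>auto simp: in_keys_iff\<close>)

lemma monom_eval_0 [simp]: "monom_eval a 0 = 1"
  by (simp add: monom_eval_def)

lemma monom_eval_add: "monom_eval a (s + t) = monom_eval a s * monom_eval a t"
  using Poly_Mapping.keys_add[of s t]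
  by (simp add: monom_eval_superset[of "Poly_Mapping.keys s \<union> Poly_Mapping.keys t"]
      lookup_add power_add prod.distrib)

text \<open>Allows several polynomials to be evaluated over one index set, although keys may cancel
  in a sum.\<close>

lemma poly_eval_superset:
  assumes "finite A" "Poly_Mapping.keys P \<subseteq> A"
  shows "poly_eval a P = (\<Sum>t\<in>A. Poly_Mapping.lookup P t * monom_eval a t)"
  unfolding poly_eval_def monom_eval_def[symmetric]
  by (rule sum.mono_neutral_left) (use assms in \<open>auto simp: in_keys_iff\<close>)

lemma poly_eval_0 [simp]: "poly_eval a 0 = 0"
  by (simp add: poly_eval_def)

lemma poly_eval_add: "poly_eval a (P + Q) = poly_eval a P + poly_eval a Q"
  using Poly_Mapping.keys_add[of P Q]
  by (simp add: poly_eval_superset[of "Poly_Mapping.keys P \<union> Poly_Mapping.keys Q"]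
      lookup_add distrib_right sum.distrib)

lemma poly_eval_sum: "poly_eval a (\<Sum>i\<in>I. f i) = (\<Sum>i\<in>I. poly_eval a (f i))"
  by (induction I rule: infinite_finite_induct) (auto simp: poly_eval_add)

lemma poly_eval_single: "poly_eval a (Poly_Mapping.single t c) = c * monom_eval a t"
  by (subst poly_eval_superset[of "{t}"]) auto

lemma poly_eval_1 [simp]: "poly_eval a 1 = 1"
  by (subst poly_eval_superset[of "{0}"]) auto

lemma poly_mapping_eq_sum_single:
  "P = (\<Sum>t\<in>Poly_Mapping.keys P. Poly_Mapping.single t (Poly_Mapping.lookup P t))"
proof (rule poly_mapping_eqI)
  fix k
  have "Poly_Mapping.lookup (\<Sum>t\<in>Poly_Mapping.keys P. Poly_Mapping.single t (Poly_Mapping.lookup P t)) k =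
      (\<Sum>t\<in>Poly_Mapping.keys P. if t = k then Poly_Mapping.lookup P t else 0)"
    by (simp add: lookup_sum lookup_single when_def)
  also have "\<dots> = Poly_Mapping.lookup P k"
    by (auto simp: in_keys_iff)
  finally show "Poly_Mapping.lookup P k = Poly_Mapping.lookup
      (\<Sum>t\<in>Poly_Mapping.keys P. Poly_Mapping.single t (Poly_Mapping.lookup P t)) k" ..
qed

lemma poly_eval_mult: "poly_eval a (P * Q) = poly_eval a P * poly_eval a Q"
proof -
  have "P * Q = (\<Sum>s\<in>Poly_Mapping.keys P. \<Sum>t\<in>Poly_Mapping.keys Q.
      Poly_Mapping.single (s + t) (Poly_Mapping.lookup P s * Poly_Mapping.lookup Q t))"
    using arg_cong2[where f = "(*)", OF poly_mapping_eq_sum_single[of P] poly_mapping_eq_sum_single[of Q]]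
    by (simp only: sum_product mult_single)
  then have "poly_eval a (P * Q) = (\<Sum>s\<in>Poly_Mapping.keys P. \<Sum>t\<in>Poly_Mapping.keys Q.
      (Poly_Mapping.lookup P s * monom_eval a s) * (Poly_Mapping.lookup Q t * monom_eval a t))"
    by (simp only: poly_eval_sum poly_eval_single monom_eval_add mult_ac)
  also have "\<dots> = poly_eval a P * poly_eval a Q"
    by (simp only: poly_eval_def monom_eval_def sum_product)
  finally show ?thesis .
qed

lemma comm_ring_hom_poly_eval: "comm_ring_hom (poly_eval a)"
  by unfold_locales (simp_all only: poly_eval_add poly_eval_mult poly_eval_0 poly_eval_1)

lemma poly_eval_indet: "poly_eval a (indet i) = a i"
  by (simp add: indet_def poly_eval_single monom_eval_def)

text \<open>The bound on the variables becomes membership in a set closed under the ring operations,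
  hence under determinants.\<close>

definition polys_in :: "nat set \<Rightarrow> cpoly set" where
  "polys_in S = {P. poly_vars P \<subseteq> S}"

lemma polys_in_iff:
  "P \<in> polys_in S \<longleftrightarrow> (\<forall>t\<in>Poly_Mapping.keys P. Poly_Mapping.keys t \<subseteq> S)"
  by (auto simp: polys_in_def poly_vars_def)

lemma polys_in_0 [simp]: "0 \<in> polys_in S" and polys_in_1 [simp]: "1 \<in> polys_in S"
  by (auto simp: polys_in_iff)

lemma polys_in_indet: "i \<in> S \<Longrightarrow> indet i \<in> polys_in S"
  by (simp add: polys_in_iff indet_def)

lemma polys_in_add:
  assumes "P \<in> polys_in S" "Q \<in> polys_in S"
  shows "P + Q \<in> polys_in S"
  unfolding polys_in_iff
proof
  fix t assume "t \<in> Poly_Mapping.keys (P + Q)"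
  then have "t \<in> Poly_Mapping.keys P \<union> Poly_Mapping.keys Q"
    by (rule subsetD[OF Poly_Mapping.keys_add])
  then show "Poly_Mapping.keys t \<subseteq> S"
    using assms unfolding polys_in_iff by blast
qed

lemma polys_in_mult:
  assumes "P \<in> polys_in S" "Q \<in> polys_in S"
  shows "P * Q \<in> polys_in S"
  unfolding polys_in_iff
proof
  fix t assume "t \<in> Poly_Mapping.keys (P * Q)"
  then obtain p q where t: "t = p + q" "p \<in> Poly_Mapping.keys P" "q \<in> Poly_Mapping.keys Q"
    using Poly_Mapping.keys_mult[of P Q] by blast
  then have "Poly_Mapping.keys p \<union> Poly_Mapping.keys q \<subseteq> S"
    using assms unfolding polys_in_iff by blast
  then show "Poly_Mapping.keys t \<subseteq> S"
    unfolding t(1) using Poly_Mapping.keys_add[of p q] by (rule subset_trans[rotated])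
qed

lemma polys_in_uminus: "P \<in> polys_in S \<Longrightarrow> - P \<in> polys_in S"
  by (simp add: polys_in_iff in_keys_iff)

lemma polys_in_det:
  assumes "\<And>i j. i < n \<Longrightarrow> j < n \<Longrightarrow> f (i, j) \<in> polys_in S"
  shows "det (mat n n f) \<in> polys_in S"
proof -
  have sum: "(\<Sum>i\<in>I. g i) \<in> polys_in S" if "\<And>i. i \<in> I \<Longrightarrow> g i \<in> polys_in S" for I :: "'i set" and g
    using that by (induction I rule: infinite_finite_induct) (auto intro: polys_in_add)
  have prod: "(\<Prod>i\<in>I. g i) \<in> polys_in S" if "\<And>i. i \<in> I \<Longrightarrow> g i \<in> polys_in S" for I :: "'i set" and g
    using that by (induction I rule: infinite_finite_induct) (auto intro: polys_in_mult)
  have "signof p * (\<Prod>i = 0..<n. mat n n f $$ (i, p i)) \<in> polys_in S" if "p permutes {0..<n}" for p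
  proof (rule polys_in_mult[OF _ prod])
    show "signof p \<in> polys_in S"
      by (cases "evenperm p") (simp_all add: sign_def polys_in_uminus)
  qed (use that assms in \<open>auto simp: permutes_less_iff\<close>)
  then show ?thesis
    using sum[of "{p. p permutes {0..<n}}"] by (simp add: det_def'[of _ n])
qed

lemma polys_in_hankel_det: "(\<And>n. u n \<in> polys_in S) \<Longrightarrow> hankel_det u d \<in> polys_in S"
  unfolding hankel_det_def by (rule polys_in_det) simp

lemma polys_in_toeplitz_det: "(\<And>s. a s \<in> polys_in S) \<Longrightarrow> toeplitz_det a n \<in> polys_in S"
  unfolding toeplitz_det_def by (rule polys_in_det) simp

lemma poly_vars_sym_H: "poly_vars (sym_H m indet) \<subseteq> {0..m}"
proof -
  have "sym_coeff m indet s \<in> polys_in {0..m}" for s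
    by (simp add: sym_coeff_def polys_in_indet nat_le_iff)
  then have "sym_H m indet \<in> polys_in {0..m}"
    unfolding sym_H_def sym_D_def by (intro polys_in_hankel_det polys_in_toeplitz_det)
  then show ?thesis by (simp add: polys_in_def)
qed

lemma poly_vars_skew_H: "poly_vars (skew_H m indet) \<subseteq> {1..m}"
proof -
  have "skew_coeff m indet s \<in> polys_in {1..m}" for s
    by (simp add: skew_coeff_def polys_in_indet polys_in_uminus nat_le_iff le_nat_iff)
  then have "skew_H m indet \<in> polys_in {1..m}"
    unfolding skew_H_def skew_D_def by (intro polys_in_hankel_det polys_in_toeplitz_det)
  then show ?thesis by (simp add: polys_in_def)
qed

lemma poly_eval_sym_H: "poly_eval a (sym_H m indet) = sym_H m a"
  using comm_ring_hom.hom_sym_H[OF comm_ring_hom_poly_eval, of a m indet] by (simp only: poly_eval_indet)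

lemma poly_eval_skew_H: "poly_eval a (skew_H m indet) = skew_H m a"
  using comm_ring_hom.hom_skew_H[OF comm_ring_hom_poly_eval, of a m indet] by (simp only: poly_eval_indet)

section \<open>Products over half of a set of paired roots\<close>

lemma ternary_sum_less:
  fixes d :: "nat \<Rightarrow> nat"
  assumes "\<And>i. i < n \<Longrightarrow> d i < 3"
  shows "(\<Sum>i<n. d i * 3 ^ i) < 3 ^ n"
  using assms
proof (induction n)
  case (Suc n)
  have "d n * 3 ^ n \<le> 2 * 3 ^ n" using Suc.prems[of n] by simp
  moreover have "(\<Sum>i<n. d i * 3 ^ i) < 3 ^ n" using Suc by simp
  ultimately have "(\<Sum>i<n. d i * 3 ^ i) + d n * 3 ^ n < 3 ^ n + 2 * 3 ^ n"
    by (rule add_less_le_mono[rotated])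
  then show ?case by simp
qed simp

lemma ternary_digit_sum:
  fixes d :: "nat \<Rightarrow> nat"
  assumes "\<And>i. i < n \<Longrightarrow> d i < 3" and "j < n"
  shows "(\<Sum>i<n. d i * 3 ^ i) div 3 ^ j mod 3 = d j"
  using assms
proof (induction n)
  case (Suc n)
  show ?case
  proof (cases "j = n")
    case True
    have "(\<Sum>i<n. d i * 3 ^ i) < 3 ^ n"
      by (rule ternary_sum_less) (use Suc.prems in simp)
    then show ?thesis using True Suc.prems(1)[of n] by simp
  next
    case False
    with Suc.prems have j: "j < n" by simp
    \<comment> \<open>For j < n the top term is a multiple of 3^(j+1) and does not affect digit
      j.\<close>
    have "n - Suc j + 1 + j = n" using j by simp
    then have "(3::nat) ^ n = 3 ^ (n - Suc j) * 3 ^ 1 * 3 ^ j"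
      by (simp only: power_add[symmetric])
    then have "(\<Sum>i<Suc n. d i * 3 ^ i) = (\<Sum>i<n. d i * 3 ^ i) + d n * 3 ^ (n - Suc j) * 3 * 3 ^ j"
      by (simp only: sum.lessThan_Suc mult.assoc power_one_right)
    then have "(\<Sum>i<Suc n. d i * 3 ^ i) div 3 ^ j = (\<Sum>i<n. d i * 3 ^ i) div 3 ^ j + d n * 3 ^ (n - Suc j) * 3"
      using div_mult_self1[of "3 ^ j" "\<Sum>i<n. d i * 3 ^ i" "d n * 3 ^ (n - Suc j) * 3"]
      by (simp del: sum.lessThan_Suc)
    then show ?thesis using Suc j by simp
  qed
qed simp

lemma ternary_expansion:
  fixes t :: nat
  shows "(\<Sum>j<n. (t div 3 ^ j mod 3) * 3 ^ j) = t mod 3 ^ n"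
proof (induction n)
  case (Suc n)
  have "t mod 3 ^ Suc n = 3 ^ n * (t div 3 ^ n mod 3) + t mod 3 ^ n"
    by (metis mod_mult2_eq power_Suc2)
  with Suc show ?case by (simp add: mult.commute)
qed simp

text \<open>Positions of the roots: \<open>hi j\<close> and \<open>lo j\<close> carry a root and its inverse, \<open>E\<close> the remaining roots.\<close>
locale paired_positions =
  fixes n N s :: nat and hi lo :: "nat \<Rightarrow> nat" and E :: "nat set"
  assumes cover: "{..<N} = E \<union> (hi ` {..<n} \<union> lo ` {..<n})"
    and disj: "E \<inter> (hi ` {..<n} \<union> lo ` {..<n}) = {}" "hi ` {..<n} \<inter> lo ` {..<n} = {}"
    and inj: "inj_on hi {..<n}" "inj_on lo {..<n}"
    and sum_pair: "\<And>j. j < n \<Longrightarrow> hi j + lo j = s"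
begin

lemma finite_E: "finite E"
  using cover by (metis finite_Un finite_lessThan)

text \<open>Proved for an arbitrary commutative monoid in order to obtain the splitting of sums and
  of products at once.\<close>

lemma (in comm_monoid_set) split_positions:
  assumes "paired_positions n N s hi lo E"
  shows "F g {..<N} = f (F g E) (F (\<lambda>j. f (g (hi j)) (g (lo j))) {..<n})"
proof -
  interpret paired_positions n N s hi lo E by fact
  have "F g {..<N} = f (F g E) (F g (hi ` {..<n} \<union> lo ` {..<n}))"
    unfolding cover by (rule union_disjoint) (auto simp: finite_E disj)
  also have "F g (hi ` {..<n} \<union> lo ` {..<n}) = f (F g (hi ` {..<n})) (F g (lo ` {..<n}))"
    by (rule union_disjoint) (auto simp: disj)
  also have "\<dots> = F (\<lambda>j. f (g (hi j)) (g (lo j))) {..<n}"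
    by (simp add: reindex inj distrib)
  finally show ?thesis .
qed

lemmas sum_split = sum.split_positions[OF paired_positions_axioms]
lemmas prod_split = prod.split_positions[OF paired_positions_axioms]

text \<open>One plus the exponent with which the root at \<open>hi j\<close> enters the product over
  M: 2 for \<open>hi j\<close> alone, 0 for \<open>lo j\<close> alone, 1 for both or
  neither.\<close>

definition digit :: "nat set \<Rightarrow> nat \<Rightarrow> nat" where
  "digit M j = (if hi j \<in> M then 1 else 0) + (if lo j \<in> M then 0 else 1)"

definition code :: "nat set \<Rightarrow> nat" where
  "code M = (\<Sum>j<n. digit M j * 3 ^ j)"

lemma digit_less: "digit M j < 3"
  by (simp add: digit_def)

lemma code_less: "code M < 3 ^ n"
  unfolding code_def by (rule ternary_sum_less) (rule digit_less)

lemma digit_code: "j < n \<Longrightarrow> digit M j = code M div 3 ^ j mod 3"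
  unfolding code_def by (rule ternary_digit_sum[symmetric]) (rule digit_less)

text \<open>Multiplication by all \<open>r j\<close> shifts the exponents -1, 0, 1 to the digits 0,
  1, 2, so that only natural powers occur.\<close>

lemma prod_positions:
  fixes x :: "nat \<Rightarrow> 'a::field"
  assumes M: "M \<subseteq> {..<N}" and x: "\<And>j. j < n \<Longrightarrow> x (hi j) = r j" "\<And>j. j < n \<Longrightarrow> x (lo j) = inverse (r j)"
    and r: "\<And>j. j < n \<Longrightarrow> r j \<noteq> 0"
  shows "(\<Prod>i\<in>M. x i) * (\<Prod>j<n. r j) = (\<Prod>i\<in>M \<inter> E. x i) * (\<Prod>j<n. r j ^ (code M div 3 ^ j mod 3))"
proof -
  have "(\<Prod>i\<in>M. x i) = (\<Prod>i<N. if i \<in> M then x i else 1)"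
    using M by (simp add: prod.inter_restrict[symmetric] Int_absorb1)
  also have "\<dots> = (\<Prod>i\<in>M \<inter> E. x i) *
      (\<Prod>j<n. (if hi j \<in> M then r j else 1) * (if lo j \<in> M then inverse (r j) else 1))"
    unfolding prod_split Int_commute[of M] prod.inter_restrict[OF finite_E]
    using x by (intro arg_cong2[where f = "(*)"] prod.cong) auto
  finally have "(\<Prod>i\<in>M. x i) * (\<Prod>j<n. r j) = (\<Prod>i\<in>M \<inter> E. x i) *
      (\<Prod>j<n. (if hi j \<in> M then r j else 1) * (if lo j \<in> M then inverse (r j) else 1) * r j)"
    by (simp add: prod.distrib mult.assoc)
  also have "(\<Prod>j<n. (if hi j \<in> M then r j else 1) * (if lo j \<in> M then inverse (r j) else 1) * r j) =
      (\<Prod>j<n. r j ^ digit M j)"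
    using r by (intro prod.cong) (auto simp: digit_def)
  also have "(\<Prod>j<n. r j ^ digit M j) = (\<Prod>j<n. r j ^ (code M div 3 ^ j mod 3))"
    by (intro prod.cong) (auto simp: digit_code)
  finally show ?thesis .
qed

text \<open>A pair contributes its digit minus one, plus two if its \<open>lo\<close> position is in
  M. Hence the cardinality, the digits and the part in E fix the number of \<open>lo\<close>
  positions, and modulo 2 that number drops out.\<close>

lemma card_positions:
  assumes M: "M \<subseteq> {..<N}"
  shows "int (card M) + int n = int (card (M \<inter> E)) + (\<Sum>j<n. int (digit M j)) + 2 * (\<Sum>j<n. if lo j \<in> M then 1 else 0)"
proof -
  have "int (card M) = (\<Sum>i<N. if i \<in> M then 1 else 0)"
    using M by (simp add: sum.inter_restrict[symmetric] Int_absorb1)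
  also have "\<dots> = int (card (M \<inter> E)) + (\<Sum>j<n. (if hi j \<in> M then 1 else 0) + (if lo j \<in> M then 1 else 0))"
    by (simp add: sum_split finite_E Int_commute[of M] flip: sum.inter_restrict)
  also have "(\<Sum>j<n. (if hi j \<in> M then 1 else 0) + (if lo j \<in> M then 1 else 0)) =
      (\<Sum>j<n. int (digit M j) + 2 * (if lo j \<in> M then 1 else 0) - 1)"
    by (intro sum.cong) (auto simp: digit_def)
  finally show ?thesis by (simp add: sum.distrib sum_subtractf sum_distrib_left)
qed

text \<open>Because all pairs have the same position sum s, the \<open>lo\<close> positions enter,
  beyond the digits, only through their number.\<close>

lemma sum_positions:
  assumes M: "M \<subseteq> {..<N}"
  shows "(\<Sum>i\<in>M. int i) = (\<Sum>i\<in>M \<inter> E. int i) + (\<Sum>j<n. (int (digit M j) - 1) * int (hi j)) +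
    int s * (\<Sum>j<n. if lo j \<in> M then 1 else 0)"
proof -
  have "(\<Sum>i\<in>M. int i) = (\<Sum>i<N. if i \<in> M then int i else 0)"
    using M by (simp add: sum.inter_restrict[symmetric] Int_absorb1)
  also have "\<dots> = (\<Sum>i\<in>M \<inter> E. int i) +
      (\<Sum>j<n. (if hi j \<in> M then int (hi j) else 0) + (if lo j \<in> M then int (lo j) else 0))"
    by (simp add: sum_split finite_E Int_commute[of M] flip: sum.inter_restrict)
  also have "(\<Sum>j<n. (if hi j \<in> M then int (hi j) else 0) + (if lo j \<in> M then int (lo j) else 0)) =
      (\<Sum>j<n. (int (digit M j) - 1) * int (hi j) + int s * (if lo j \<in> M then 1 else 0))"
  proof (intro sum.cong refl)
    fix j assume "j \<in> {..<n}"
    then have "int s = int (hi j) + int (lo j)" using sum_pair[of j] by simp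
    then show "(if hi j \<in> M then int (hi j) else 0) + (if lo j \<in> M then int (lo j) else 0) =
        (int (digit M j) - 1) * int (hi j) + int s * (if lo j \<in> M then 1 else 0)"
      by (auto simp: digit_def)
  qed
  finally show ?thesis by (simp add: sum.distrib sum_distrib_left)
qed

text \<open>By \<open>card_positions\<close> both sets contain equally many \<open>lo\<close>
  positions, so \<open>sum_positions\<close> gives the same value. This makes the signs in
  \<open>split_vandermonde_sign\<close> agree for sets with equal products.\<close>

lemma sum_positions_eqI:
  assumes "M \<subseteq> {..<N}" "M' \<subseteq> {..<N}" "card M = card M'" "M \<inter> E = M' \<inter> E" "code M = code M'"
  shows "\<Sum>M = \<Sum>M'"
proof -
  have dig: "digit M j = digit M' j" if "j < n" for j
    using that assms(5) by (simp add: digit_code)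
  have "(\<Sum>j<n. if lo j \<in> M then 1 else 0) = ((\<Sum>j<n. if lo j \<in> M' then 1 else 0) :: int)"
    using card_positions[OF assms(1)] card_positions[OF assms(2)] assms(3,4) dig by simp
  then have "(\<Sum>i\<in>M. int i) = (\<Sum>i\<in>M'. int i)"
    using sum_positions[OF assms(1)] sum_positions[OF assms(2)] assms(4) dig by simp
  then show ?thesis by (simp flip: of_nat_sum)
qed

text \<open>Powers of 3 are odd, so the code has the parity of its digit sum, which
  \<open>card_positions\<close> relates to the cardinality modulo 2.\<close>

lemma parity_code:
  assumes "M \<subseteq> {..<N}"
  shows "even (card M + n) \<longleftrightarrow> even (card (M \<inter> E) + code M)"
proof -
  have "even (\<Sum>j<n. digit M j * 3 ^ j) \<longleftrightarrow> even (\<Sum>j<n. digit M j)" for n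
    by (induction n) auto
  moreover have "even (int (card M) + int n) \<longleftrightarrow> even (int (card (M \<inter> E)) + (\<Sum>j<n. int (digit M j)))"
    by (simp add: card_positions[OF assms])
  then have "even (card M + n) \<longleftrightarrow> even (card (M \<inter> E) + (\<Sum>j<n. digit M j))"
    by (simp flip: of_nat_sum of_nat_add)
  ultimately show ?thesis by (simp add: code_def)
qed

text \<open>A digit 2 forces the \<open>hi\<close> position alone, a digit 0 the \<open>lo\<close>
  position alone; a digit 1 leaves the choice between the full pair and nothing. The number k counts
  the full pairs, and the equation for c is the resulting count of elements.\<close>

lemma ex_positions:
  assumes t: "t < 3 ^ n" and E': "E' \<subseteq> E"
    and k: "k \<le> card {j. j < n \<and> t div 3 ^ j mod 3 = 1}"
    and c: "c + card {j. j < n \<and> t div 3 ^ j mod 3 = 1} = 2 * k + card E' + n"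
  shows "\<exists>M\<subseteq>{..<N}. card M = c \<and> M \<inter> E = E' \<and> code M = t"
proof -
  define d where "d j = t div 3 ^ j mod 3" for j
  define Z where "Z = {j. j < n \<and> d j = 1}"
  obtain K where K: "K \<subseteq> Z" "card K = k"
    using k obtain_subset_with_card_n[of k Z] unfolding Z_def d_def by blast
  define A where "A = {j. j < n \<and> d j = 2} \<union> K"
  define B where "B = {j. j < n \<and> d j = 0} \<union> K"
  define M where "M = E' \<union> (hi ` A \<union> lo ` B)"
  have AB: "A \<subseteq> {..<n}" "B \<subseteq> {..<n}" using K by (auto simp: A_def B_def Z_def)
  have d3: "d j < 3" for j by (simp add: d_def)
  have hiM: "hi j \<in> M \<longleftrightarrow> j \<in> A" and loM: "lo j \<in> M \<longleftrightarrow> j \<in> B" if "j < n" for j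
  proof -
    have "hi j \<notin> E" "lo j \<notin> E" "hi j \<notin> lo ` {..<n}" "lo j \<notin> hi ` {..<n}"
      using disj that by auto
    then show "hi j \<in> M \<longleftrightarrow> j \<in> A" "lo j \<in> M \<longleftrightarrow> j \<in> B"
      using E' AB inj_onD[OF inj(1), of j] inj_onD[OF inj(2), of j] that by (auto simp: M_def)
  qed
  have dig: "digit M j = d j" if "j < n" for j
  proof -
    have "j \<in> A \<longleftrightarrow> d j = 2 \<or> j \<in> K" "j \<in> B \<longleftrightarrow> d j = 0 \<or> j \<in> K" "j \<in> K \<longrightarrow> d j = 1"
      using that K by (auto simp: A_def B_def Z_def)
    then show ?thesis using d3[of j] by (auto simp: digit_def hiM[OF that] loM[OF that])
  qed
  have code: "code M = t"
    using t ternary_expansion[of t n] by (simp add: code_def dig d_def)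
  have sub: "M \<subseteq> {..<N}" using cover E' AB unfolding M_def by blast
  have ME: "M \<inter> E = E'"
    using E' AB disj unfolding M_def by blast
  have fin: "finite E'" "finite A" "finite B" "finite K"
    using finite_subset[OF E' finite_E] AB[THEN finite_subset] by (auto simp: A_def)
  have "card M = card E' + (card A + card B)"
  proof -
    have "card (hi ` A \<union> lo ` B) = card (hi ` A) + card (lo ` B)"
      using fin disj(2) AB by (intro card_Un_disjoint) blast+
    moreover have "card (hi ` A) = card A" "card (lo ` B) = card B"
      using card_image[OF inj_on_subset[OF inj(1) AB(1)]] card_image[OF inj_on_subset[OF inj(2) AB(2)]] by simp_all
    moreover have "card M = card E' + card (hi ` A \<union> lo ` B)"
      unfolding M_def using fin disj(1) E' AB by (intro card_Un_disjoint) blast+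
    ultimately show ?thesis by simp
  qed
  moreover have "card A = card {j. j < n \<and> d j = 2} + k"
    unfolding A_def K(2)[symmetric] using K(1) fin by (intro card_Un_disjoint) (auto simp: Z_def)
  moreover have "card B = card {j. j < n \<and> d j = 0} + k"
    unfolding B_def K(2)[symmetric] using K(1) fin by (intro card_Un_disjoint) (auto simp: Z_def)
  moreover have "card {j. j < n \<and> d j = 2} + card {j. j < n \<and> d j = 0} + card Z = n"
  proof -
    have "d j = 0 \<or> d j = 1 \<or> d j = 2" for j
      using d3[of j] by linarith
    then have "{..<n} = ({j. j < n \<and> d j = 2} \<union> {j. j < n \<and> d j = 0}) \<union> Z"
      unfolding Z_def by blast
    then have "n = card (({j. j < n \<and> d j = 2} \<union> {j. j < n \<and> d j = 0}) \<union> Z)"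
      by (metis card_lessThan)
    also have "\<dots> = card ({j. j < n \<and> d j = 2} \<union> {j. j < n \<and> d j = 0}) + card Z"
      by (rule card_Un_disjoint) (auto simp: Z_def)
    also have "card ({j. j < n \<and> d j = 2} \<union> {j. j < n \<and> d j = 0}) =
        card {j. j < n \<and> d j = 2} + card {j. j < n \<and> d j = 0}"
      by (rule card_Un_disjoint) auto
    finally show ?thesis by simp
  qed
  moreover have "c + card Z = 2 * k + card E' + n"
    using c by (simp add: Z_def d_def)
  ultimately have "card M = c" by linarith
  with sub ME code show ?thesis by blast
qed

end

section \<open>Exponential sums over half of the roots\<close>

definition half_sets :: "nat \<Rightarrow> nat set set" where
  "half_sets m = {M. M \<subseteq> {..<2 * m} \<and> card M = m}"

lemma finite_half_sets [simp]: "finite (half_sets m)"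
  by (rule finite_subset[of _ "Pow {..<2 * m}"]) (auto simp: half_sets_def)

text \<open>Rows are arbitrary and columns consecutive. This includes the minors whose first d rows
  are fixed and whose last row runs through all n, as needed for the recurrence.\<close>

definition minors_vanish :: "nat \<Rightarrow> (nat \<Rightarrow> 'a::comm_ring_1) \<Rightarrow> bool" where
  "minors_vanish d u \<longleftrightarrow> (\<forall>p. det (mat (Suc d) (Suc d) (\<lambda>(i, j). u (p i + j))) = 0)"

lemma vandermonde_neq_0:
  fixes x :: "nat \<Rightarrow> 'a::idom"
  assumes "inj_on x {..<n}"
  shows "(\<Prod>i<n. \<Prod>l<i. x i - x l) \<noteq> 0"
  using inj_onD[OF assms] by fastforce

lemma toeplitz_det_eq_exponential_sum:
  fixes x :: "nat \<Rightarrow> 'a::field" and m n :: nat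
  assumes deg: "degree f \<le> 2 * m" and roots: "\<And>i. i < 2 * m \<Longrightarrow> poly f (x i) = 0"
    and inj: "inj_on x {..<2 * m}"
  shows "toeplitz_det (band_coeff m f) n =
    (\<Sum>M\<in>half_sets m. split_vandermonde m (2 * m) x M / (\<Prod>i<2 * m. \<Prod>l<i. x i - x l) *
      ((-1) ^ m * coeff f (2 * m) * (\<Prod>i\<in>M. x i)) ^ n)"
proof -
  let ?V = "\<Prod>i<2 * m. \<Prod>l<i. x i - x l"
  have "?V \<noteq> 0" by (rule vandermonde_neq_0[OF inj])
  then have "toeplitz_det (band_coeff m f) n = toeplitz_det (band_coeff m f) n * ?V / ?V" by simp
  also have "toeplitz_det (band_coeff m f) n * ?V = (\<Sum>M\<in>half_sets m. split_vandermonde m (2 * m) x M *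
       ((-1) ^ m * coeff f (2 * m) * (\<Prod>i\<in>M. x i)) ^ n)"
    unfolding half_sets_def by (rule toeplitz_det_exponential_sum[OF deg roots])
  finally show ?thesis
    by (simp only: sum_divide_distrib times_divide_eq_left)
qed

text \<open>The common factor of the bases, even if it is zero, cannot increase their number, so
  counting the products of roots suffices.\<close>

lemma minors_vanish_toeplitz_det:
  fixes x :: "nat \<Rightarrow> 'a::field"
  assumes deg: "degree f \<le> 2 * m" and roots: "\<And>i. i < 2 * m \<Longrightarrow> poly f (x i) = 0"
    and inj: "inj_on x {..<2 * m}" and card: "card ((\<lambda>M. \<Prod>i\<in>M. x i) ` half_sets m) \<le> d"
  shows "minors_vanish d (toeplitz_det (band_coeff m f))"
  unfolding minors_vanish_def
proof
  fix p
  let ?V = "\<Prod>i<2 * m. \<Prod>l<i. x i - x l" and ?c = "(-1) ^ m * coeff f (2 * m)"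
  have "toeplitz_det (band_coeff m f) n =
      (\<Sum>M\<in>half_sets m. split_vandermonde m (2 * m) x M / ?V * (?c * (\<Prod>i\<in>M. x i)) ^ n)" for n
    by (rule toeplitz_det_eq_exponential_sum[OF deg roots inj])
  moreover have "card ((\<lambda>M. ?c * (\<Prod>i\<in>M. x i)) ` half_sets m) \<le> d"
  proof -
    have "(\<lambda>M. ?c * (\<Prod>i\<in>M. x i)) ` half_sets m = (*) ?c ` (\<lambda>M. \<Prod>i\<in>M. x i) ` half_sets m"
      by (simp add: image_image)
    then show ?thesis using card card_image_le[of "(\<lambda>M. \<Prod>i\<in>M. x i) ` half_sets m" "(*) ?c"] by simp
  qed
  ultimately show "det (mat (Suc d) (Suc d) (\<lambda>(i, j). toeplitz_det (band_coeff m f) (p i + j))) = 0"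
    by (rule minor_exponential_sum_eq_0[OF finite_half_sets, rotated])
qed

text \<open>Sets with the same product of roots contribute coefficients of the same sign, so the
  exponentials cannot cancel.\<close>
lemma hankel_det_toeplitz_det_neq_0:
  fixes x :: "nat \<Rightarrow> real"
  assumes mono: "strict_mono_on {..<2 * m} x" and nz: "\<And>i. i < 2 * m \<Longrightarrow> x i \<noteq> 0"
    and sums: "\<And>M M'. M \<in> half_sets m \<Longrightarrow> M' \<in> half_sets m \<Longrightarrow> (\<Prod>i\<in>M. x i) = (\<Prod>i\<in>M'. x i) \<Longrightarrow> \<Sum>M = \<Sum>M'"
  shows "hankel_det (toeplitz_det (band_coeff m (\<Prod>i<2 * m. [:- x i, 1:])))
    (card ((\<lambda>M. \<Prod>i\<in>M. x i) ` half_sets m)) \<noteq> 0"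
proof -
  let ?f = "\<Prod>i<2 * m. [:- x i, 1:]"
  let ?V = "\<Prod>i<2 * m. \<Prod>l<i. x i - x l"
  have deg: "degree ?f = 2 * m"
    by (subst degree_prod_eq_sum_degree) auto
  have lead: "coeff ?f (2 * m) = 1"
    using lead_coeff_prod[of "\<lambda>i. [:- x i, 1:]" "{..<2 * m}"] deg by simp
  have roots: "poly ?f (x i) = 0" if "i < 2 * m" for i
    using that by (auto simp: poly_prod intro!: prod_zero)
  have inj: "inj_on x {..<2 * m}"
    by (rule strict_mono_on_imp_inj_on[OF mono])
  have V: "?V \<noteq> 0" by (rule vandermonde_neq_0[OF inj])
  define w where "w M = (-1) ^ m * (\<Prod>i\<in>M. x i)" for M
  define S where "S M = split_vandermonde m (2 * m) x M / ?V" for M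
  define C where "C v = (\<Sum>M\<in>{M\<in>half_sets m. w M = v}. S M)" for v
  have w_eq: "w M = w M' \<longleftrightarrow> (\<Prod>i\<in>M. x i) = (\<Prod>i\<in>M'. x i)" for M M'
    by (simp add: w_def)
  have "toeplitz_det (band_coeff m ?f) n = (\<Sum>v\<in>w ` half_sets m. C v * v ^ n)" for n
  proof -
    have "toeplitz_det (band_coeff m ?f) n = (\<Sum>M\<in>half_sets m. S M * w M ^ n)"
      using toeplitz_det_eq_exponential_sum[OF eq_imp_le[OF deg] roots inj, where n = n]
      by (simp only: w_def S_def lead mult_1_right)
    also have "\<dots> = (\<Sum>v\<in>w ` half_sets m. \<Sum>M\<in>{M\<in>half_sets m. w M = v}. S M * w M ^ n)"
      by (rule sum.image_gen) simp
    also have "\<dots> = (\<Sum>v\<in>w ` half_sets m. C v * v ^ n)"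
      by (intro sum.cong refl) (simp add: C_def sum_distrib_right)
    finally show ?thesis .
  qed
  moreover have "C v \<noteq> 0" if v: "v \<in> w ` half_sets m" for v
  proof -
    obtain M0 where M0: "M0 \<in> half_sets m" "v = w M0" using v by blast
    \<comment> \<open>All M with base \<open>v\<close> share this factor: \<open>sums\<close>
      equates their position sums, and equal bases mean equal products.\<close>
    define \<sigma> where "\<sigma> = (-1) ^ (\<Sum>M0 + \<Sum>{m..<m + m}) * (\<Prod>i\<in>M0. x i) ^ m"
    have "\<exists>r>0. split_vandermonde m (2 * m) x M = \<sigma> * r" if M: "M \<in> half_sets m" "w M = v" for M
    proof -
      have "\<Sum>M = \<Sum>M0" "(\<Prod>i\<in>M. x i) = (\<Prod>i\<in>M0. x i)"
        using sums[OF M(1) M0(1)] M(2) M0(2) w_eq[of M M0] by auto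
      moreover have "strict_mono_on M x" "strict_mono_on ({..<m + m} - M) x"
        using M by (auto intro!: monotone_on_subset[OF mono] simp: half_sets_def mult_2)
      ultimately show ?thesis
        using split_vandermonde_sign[of M m m x] M by (simp add: half_sets_def mult_2 \<sigma>_def)
    qed
    then obtain r where r: "\<And>M. M \<in> half_sets m \<Longrightarrow> w M = v \<Longrightarrow> r M > 0 \<and> split_vandermonde m (2 * m) x M = \<sigma> * r M"
      by metis
    have "C v = (\<Sum>M\<in>{M\<in>half_sets m. w M = v}. \<sigma> / ?V * r M)"
      unfolding C_def S_def using r by (intro sum.cong) auto
    also have "\<dots> = \<sigma> / ?V * (\<Sum>M\<in>{M\<in>half_sets m. w M = v}. r M)"
      by (simp only: sum_distrib_left)
    finally have C: "C v = \<sigma> / ?V * (\<Sum>M\<in>{M\<in>half_sets m. w M = v}. r M)" .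
    have "0 < (\<Sum>M\<in>{M\<in>half_sets m. w M = v}. r M)"
      by (rule sum_pos) (use r M0 in auto)
    moreover have "(\<Prod>i\<in>M0. x i) \<noteq> 0"
      using M0(1) nz finite_subset[of M0 "{..<2 * m}"] by (auto simp: half_sets_def)
    then have "\<sigma> \<noteq> 0" by (simp add: \<sigma>_def)
    ultimately show ?thesis using V by (simp only: C mult_eq_0_iff divide_eq_0_iff) simp
  qed
  ultimately have "hankel_det (toeplitz_det (band_coeff m ?f)) (card (w ` half_sets m)) \<noteq> 0"
    by (intro hankel_det_exponential_sum_neq_0) auto
  moreover have "card (w ` half_sets m) = card ((\<lambda>M. \<Prod>i\<in>M. x i) ` half_sets m)"
  proof -
    have "w ` half_sets m = (*) ((-1) ^ m) ` (\<lambda>M. \<Prod>i\<in>M. x i) ` half_sets m"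
      by (simp add: image_image w_def)
    then show ?thesis by (simp add: card_image inj_on_def)
  qed
  ultimately show ?thesis by simp
qed

text \<open>The value r + 1/r determines the pair of r and 1/r, so coincidences are possible only
  inside a pair, where they would give r^2 = 1. The roots at E have square 1 and are thereby
  separated from the pairs.\<close>

lemma (in paired_positions) inj_on_roots:
  fixes x :: "nat \<Rightarrow> 'a::field"
  assumes x: "\<And>j. j < n \<Longrightarrow> x (hi j) = r j" "\<And>j. j < n \<Longrightarrow> x (lo j) = inverse (r j)"
    and E: "inj_on x E" "\<And>i. i \<in> E \<Longrightarrow> x i ^ 2 = 1"
    and r: "\<And>j. j < n \<Longrightarrow> r j \<noteq> 0" "\<And>j. j < n \<Longrightarrow> r j ^ 2 \<noteq> 1"
    and u: "inj_on (\<lambda>j. r j + inverse (r j)) {..<n}"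
  shows "inj_on x {..<N}"
proof -
  have ne: "r j \<noteq> inverse (r l)" if "j < n" "l < n" for j l
  proof
    assume eq: "r j = inverse (r l)"
    then have "j = l" using inj_onD[OF u, of j l] that by (simp add: add.commute)
    then show False using eq r[OF that(1)] by (simp add: power2_eq_square field_simps)
  qed
  have hi_inj: "inj_on r {..<n}"
    using u by (auto simp: inj_on_def)
  have E_ne: "x i \<noteq> r j" "x i \<noteq> inverse (r j)" if "i \<in> E" "j < n" for i j
  proof -
    show "x i \<noteq> r j" using E(2) r(2) that by metis
    have "inverse (r j) ^ 2 \<noteq> 1"
      using r[OF that(2)] by (simp add: power_inverse)
    then show "x i \<noteq> inverse (r j)" using E(2) that by metis
  qed
  have HL: "inj_on x (hi ` {..<n} \<union> lo ` {..<n})"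
  proof (rule inj_onI)
    fix a b assume "a \<in> hi ` {..<n} \<union> lo ` {..<n}" "b \<in> hi ` {..<n} \<union> lo ` {..<n}" and eq: "x a = x b"
    then obtain j l where "j < n" "l < n" "a = hi j \<or> a = lo j" "b = hi l \<or> b = lo l" by auto
    then show "a = b"
      using eq ne[of j l] ne[of l j] inj_onD[OF hi_inj, of j l] x by auto
  qed
  have "x ` E \<inter> x ` (hi ` {..<n} \<union> lo ` {..<n}) = {}"
    using E_ne x by fastforce
  then show ?thesis
    unfolding cover using E(1) HL disj(1) by (subst inj_on_Un) blast
qed

text \<open>If 1 < \<open>r 0\<close> < ... < \<open>r (m - 1)\<close>, this places the reciprocals
  first, in reversed order, and then the \<open>r j\<close>, so positions follow the increasing
  order of the roots.\<close>

interpretation sym_pos: paired_positions m "2 * m" "2 * m - 1" "\<lambda>j. m + j" "\<lambda>j. m - 1 - j" "{}" for m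
proof
  show "{..<2 * m} = {} \<union> ((\<lambda>j. m + j) ` {..<m} \<union> (\<lambda>j. m - 1 - j) ` {..<m})"
  proof (intro equalityI subsetI)
    fix i assume "i \<in> {..<2 * m}"
    then show "i \<in> {} \<union> ((\<lambda>j. m + j) ` {..<m} \<union> (\<lambda>j. m - 1 - j) ` {..<m})"
      by (cases "i < m") (auto intro: image_eqI[of _ _ "i - m"] image_eqI[of _ _ "m - 1 - i"])
  qed auto
qed (auto simp: inj_on_def)

text \<open>The increasing order is now -1, the reciprocals, 1, the \<open>r j\<close>. With the
  extra roots at 0 and \<open>Suc k\<close>, the pairs still have a constant position sum.\<close>

interpretation skew_pos: paired_positions k "2 * Suc k" "2 * Suc k" "\<lambda>j. Suc (Suc k) + j" "\<lambda>j. k - j" "{0, Suc k}" for k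
proof
  show "{..<2 * Suc k} = {0, Suc k} \<union> ((\<lambda>j. Suc (Suc k) + j) ` {..<k} \<union> (\<lambda>j. k - j) ` {..<k})"
  proof (intro equalityI subsetI)
    fix i assume i: "i \<in> {..<2 * Suc k}"
    consider "i = 0" | "i = Suc k" | "0 < i" "i \<le> k" | "Suc k < i" by linarith
    then show "i \<in> {0, Suc k} \<union> ((\<lambda>j. Suc (Suc k) + j) ` {..<k} \<union> (\<lambda>j. k - j) ` {..<k})"
    proof cases
      case 3
      then show ?thesis by (auto intro: image_eqI[of _ _ "k - i"])
    next
      case 4
      then show ?thesis using i by (auto intro: image_eqI[of _ _ "i - Suc (Suc k)"])
    qed auto
  qed auto
qed (auto simp: inj_on_def)

text \<open>The powers of 3 are odd, and 1 is the only odd digit.\<close>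

lemma parity_ternary_digits:
  fixes t :: nat
  assumes "t < 3 ^ n"
  shows "even (card {j. j < n \<and> t div 3 ^ j mod 3 = 1}) \<longleftrightarrow> even t"
proof -
  have "even (\<Sum>j<n. (t div 3 ^ j mod 3) * 3 ^ j) \<longleftrightarrow> even (card {j. j < n \<and> t div 3 ^ j mod 3 = 1})" for n
  proof (induction n)
    case (Suc n)
    have "{j. j < Suc n \<and> t div 3 ^ j mod 3 = 1} = {j. j < n \<and> t div 3 ^ j mod 3 = 1} \<union>
        (if t div 3 ^ n mod 3 = 1 then {n} else {})"
      by (auto simp: less_Suc_eq)
    moreover have "odd (t div 3 ^ n mod 3) \<longleftrightarrow> t div 3 ^ n mod 3 = 1"
    proof -
      have "t div 3 ^ n mod 3 = 0 \<or> t div 3 ^ n mod 3 = 1 \<or> t div 3 ^ n mod 3 = 2" by linarith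
      then show ?thesis by auto
    qed
    ultimately show ?case using Suc by auto
  qed simp
  from this[of n] show ?thesis using assms by (simp only: ternary_expansion mod_less)
qed

text \<open>With m pairs, m elements and no further roots, \<open>parity_code\<close> forces an even
  code. Conversely an even code has an even number of digits 1, and taking half of these pairs in
  full gives m elements.\<close>

lemma sym_code_image: "sym_pos.code m ` half_sets m = {t. t < 3 ^ m \<and> even t}"
proof (intro equalityI subsetI)
  fix t assume "t \<in> sym_pos.code m ` half_sets m"
  then obtain M where M: "M \<subseteq> {..<2 * m}" "card M = m" "t = sym_pos.code m M"
    by (auto simp: half_sets_def)
  then show "t \<in> {t. t < 3 ^ m \<and> even t}"
    using sym_pos.code_less[of m M] sym_pos.parity_code[OF M(1)] by simp
next
  fix t :: nat assume "t \<in> {t. t < 3 ^ m \<and> even t}"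
  then have t: "t < 3 ^ m" "even t" by auto
  let ?z = "card {j. j < m \<and> t div 3 ^ j mod 3 = 1}"
  have "even ?z" using parity_ternary_digits[OF t(1)] t(2) by simp
  then have "m + ?z = 2 * (?z div 2) + card {} + m" by simp
  then obtain M where "M \<subseteq> {..<2 * m}" "card M = m" "sym_pos.code m M = t"
    using sym_pos.ex_positions[OF t(1), of "{}" "?z div 2" m] by auto
  then show "t \<in> sym_pos.code m ` half_sets m"
    by (auto simp: half_sets_def)
qed

text \<open>The root 1 at \<open>Suc k\<close> changes the cardinality but not the product. It
  repairs the parity, so the code and the presence of the root -1 can be prescribed
  independently.\<close>

lemma skew_code_image:
  "(\<lambda>M. (0 \<in> M, skew_pos.code k M)) ` half_sets (Suc k) = UNIV \<times> {..<3 ^ k}"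
proof (intro equalityI subsetI)
  fix bt assume "bt \<in> (\<lambda>M. (0 \<in> M, skew_pos.code k M)) ` half_sets (Suc k)"
  then show "bt \<in> UNIV \<times> {..<3 ^ k}" using skew_pos.code_less by auto
next
  fix bt :: "bool \<times> nat" assume "bt \<in> UNIV \<times> {..<3 ^ k}"
  then obtain b t where bt: "bt = (b, t)" and t: "t < 3 ^ k" by auto
  let ?z = "card {j. j < k \<and> t div 3 ^ j mod 3 = 1}"
  have "\<exists>E' h. E' \<subseteq> {0, Suc k} \<and> (0 \<in> E' \<longleftrightarrow> b) \<and> h \<le> ?z \<and> Suc k + ?z = 2 * h + card E' + k"
  proof (cases "even ?z")
    case True
    then obtain h where "?z = 2 * h" by blast
    then show ?thesis by (intro exI[of _ "if b then {0} else {Suc k}"] exI[of _ h]) auto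
  next
    case False
    then obtain h where "?z = Suc (2 * h)" using oddE by fastforce
    then show ?thesis
      by (intro exI[of _ "if b then {0, Suc k} else {}"] exI[of _ "if b then h else Suc h"]) auto
  qed
  then obtain E' h where E': "E' \<subseteq> {0, Suc k}" "0 \<in> E' \<longleftrightarrow> b" "h \<le> ?z" "Suc k + ?z = 2 * h + card E' + k"
    by blast
  obtain M where M: "M \<subseteq> {..<2 * Suc k}" "card M = Suc k" "M \<inter> {0, Suc k} = E'" "skew_pos.code k M = t"
    using skew_pos.ex_positions[OF t E'(1,3,4)] by blast
  have "0 \<in> M \<longleftrightarrow> b" using M(3) E'(2) by blast
  then show "bt \<in> (\<lambda>M. (0 \<in> M, skew_pos.code k M)) ` half_sets (Suc k)"
    using M unfolding bt half_sets_def by (intro image_eqI[of _ _ M]) auto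
qed

lemma card_even_less: "card {t::nat. t < 3 ^ m \<and> even t} = (3 ^ m + 1) div 2"
proof -
  have "odd ((3::nat) ^ m)" by simp
  then obtain q where q: "(3::nat) ^ m = 2 * q + 1" by (rule oddE)
  have "{t::nat. t < 3 ^ m \<and> even t} = (*) 2 ` {..<Suc q}"
    unfolding q by (auto elim!: evenE)
  then show ?thesis by (simp add: card_image inj_on_def q)
qed

section \<open>Parameter points with nonvanishing Hankel determinant\<close>

definition sym_roots :: "nat \<Rightarrow> (nat \<Rightarrow> 'a::field) \<Rightarrow> nat \<Rightarrow> 'a" where
  "sym_roots m r i = (if m \<le> i then r (i - m) else inverse (r (m - 1 - i)))"

definition skew_roots :: "nat \<Rightarrow> (nat \<Rightarrow> 'a::field) \<Rightarrow> nat \<Rightarrow> 'a" where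
  "skew_roots k r i = (if i = 0 then - 1 else if i = Suc k then 1
     else if Suc k < i then r (i - Suc (Suc k)) else inverse (r (k - i)))"

text \<open>For u = r + 1/r a factor has the roots r and 1/r. In terms of u no choice between the
  two is made, and the coefficients are polynomials in the parameters.\<close>

definition pair_poly :: "nat \<Rightarrow> (nat \<Rightarrow> 'a::comm_ring_1) \<Rightarrow> 'a poly" where
  "pair_poly n u = (\<Prod>j<n. [:1, - u j, 1:])"

lemma sym_roots_simps [simp]:
  "sym_roots m r (m + j) = r j"
  "j < m \<Longrightarrow> sym_roots m r (m - Suc j) = inverse (r j)"
  by (auto simp: sym_roots_def)

lemma skew_roots_simps [simp]:
  "skew_roots k r 0 = - 1" "skew_roots k r (Suc k) = 1"
  "skew_roots k r (Suc (Suc (k + j))) = r j"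
  "j < k \<Longrightarrow> skew_roots k r (k - j) = inverse (r j)"
  by (auto simp: skew_roots_def)

lemma sym_roots_poly:
  fixes r :: "nat \<Rightarrow> 'a::field"
  assumes "\<And>j. j < m \<Longrightarrow> r j \<noteq> 0"
  shows "(\<Prod>i<2 * m. [:- sym_roots m r i, 1:]) = pair_poly m (\<lambda>j. r j + inverse (r j))"
  unfolding sym_pos.prod_split pair_poly_def
  using assms by (auto intro!: prod.cong)

lemma skew_roots_poly:
  fixes r :: "nat \<Rightarrow> 'a::field"
  assumes "\<And>j. j < k \<Longrightarrow> r j \<noteq> 0"
  shows "(\<Prod>i<2 * Suc k. [:- skew_roots k r i, 1:]) = [:- 1, 0, 1:] * pair_poly k (\<lambda>j. r j + inverse (r j))"
proof -
  have "(\<Prod>i\<in>{0, Suc k}. [:- skew_roots k r i, 1:]) = [:- 1, 0, 1:]" by simp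
  moreover have "(\<Prod>j<k. [:- skew_roots k r (Suc (Suc k) + j), 1:] * [:- skew_roots k r (k - j), 1:]) =
      pair_poly k (\<lambda>j. r j + inverse (r j))"
    unfolding pair_poly_def using assms by (intro prod.cong) auto
  ultimately show ?thesis
    unfolding skew_pos.prod_split by simp
qed

text \<open>Each \<open>r j\<close> has as exponent its digit minus one; the division provides the
  negative exponents.\<close>

definition ternary_prod :: "nat \<Rightarrow> (nat \<Rightarrow> 'a::field) \<Rightarrow> nat \<Rightarrow> 'a" where
  "ternary_prod n r t = (\<Prod>j<n. r j ^ (t div 3 ^ j mod 3)) / (\<Prod>j<n. r j)"

lemma prod_sym_roots:
  fixes r :: "nat \<Rightarrow> 'a::field"
  assumes "M \<in> half_sets m" "\<And>j. j < m \<Longrightarrow> r j \<noteq> 0"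
  shows "(\<Prod>i\<in>M. sym_roots m r i) = ternary_prod m r (sym_pos.code m M)"
  using sym_pos.prod_positions[of M m "sym_roots m r" r] assms
  by (simp add: half_sets_def ternary_prod_def nonzero_eq_divide_eq)

lemma prod_skew_roots:
  fixes r :: "nat \<Rightarrow> 'a::field"
  assumes M: "M \<in> half_sets (Suc k)" and r: "\<And>j. j < k \<Longrightarrow> r j \<noteq> 0"
  shows "(\<Prod>i\<in>M. skew_roots k r i) = (if 0 \<in> M then - 1 else 1) * ternary_prod k r (skew_pos.code k M)"
proof -
  have "(\<Prod>i\<in>M \<inter> {0, Suc k}. skew_roots k r i) = (if 0 \<in> M then - 1 else 1)"
    by (cases "0 \<in> M"; cases "Suc k \<in> M") (auto simp: Int_insert_right)
  moreover have "M \<subseteq> {..<2 * Suc k}" using M by (simp add: half_sets_def)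
  note skew_pos.prod_positions[OF this, of "skew_roots k r" r]
  ultimately show ?thesis
    using r by (simp add: ternary_prod_def nonzero_eq_divide_eq)
qed

lemma sym_products_image:
  fixes r :: "nat \<Rightarrow> 'a::field"
  assumes "\<And>j. j < m \<Longrightarrow> r j \<noteq> 0"
  shows "(\<lambda>M. \<Prod>i\<in>M. sym_roots m r i) ` half_sets m = ternary_prod m r ` {t. t < 3 ^ m \<and> even t}"
  using prod_sym_roots[OF _ assms] by (simp add: image_image flip: sym_code_image cong: image_cong)

lemma skew_products_image:
  fixes r :: "nat \<Rightarrow> 'a::field"
  assumes "\<And>j. j < k \<Longrightarrow> r j \<noteq> 0"
  shows "(\<lambda>M. \<Prod>i\<in>M. skew_roots k r i) ` half_sets (Suc k) =
    (\<lambda>(b, t). (if b then - 1 else 1) * ternary_prod k r t) ` (UNIV \<times> {..<3 ^ k})"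
  using prod_skew_roots[OF _ assms] by (simp add: image_image flip: skew_code_image cong: image_cong)

text \<open>The reason for the point \<open>2 ^ 3 ^ j\<close>: up to a fixed factor the product is
  \<open>2 ^ t\<close>, so different codes give different products.\<close>

lemma ternary_prod_powers:
  assumes "t < 3 ^ n"
  shows "ternary_prod n (\<lambda>j. 2 ^ 3 ^ j :: real) t = 2 ^ t / (\<Prod>j<n. 2 ^ 3 ^ j)"
proof -
  have "(\<Prod>j<n. ((2::real) ^ 3 ^ j) ^ (t div 3 ^ j mod 3)) = 2 ^ (\<Sum>j<n. (t div 3 ^ j mod 3) * 3 ^ j)"
    by (simp add: power_sum mult.commute flip: power_mult)
  then show ?thesis using assms by (simp add: ternary_prod_def ternary_expansion)
qed

section \<open>Palindromic and antipalindromic symbols\<close>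

lemma reflect_pair_poly: "reflect_poly (pair_poly n u) = pair_poly n u"
  for u :: "nat \<Rightarrow> 'a::idom"
  unfolding pair_poly_def reflect_poly_prod by (simp add: reflect_poly_def)

lemma degree_pair_poly: "degree (pair_poly n u) = 2 * n"
  for u :: "nat \<Rightarrow> 'a::idom"
  unfolding pair_poly_def by (subst degree_prod_eq_sum_degree) auto

lemma coeff_pair_poly_symmetric:
  fixes u :: "nat \<Rightarrow> 'a::idom"
  assumes "i \<le> 2 * n"
  shows "coeff (pair_poly n u) (2 * n - i) = coeff (pair_poly n u) i"
  using arg_cong[OF reflect_pair_poly[of n u], of "\<lambda>p. coeff p i"] assms
  by (simp add: coeff_reflect_poly degree_pair_poly)

text \<open>Reflection is multiplicative, fixes the pair polynomial and negates z^2 - 1.\<close>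

lemma coeff_skew_pair_poly:
  fixes u :: "nat \<Rightarrow> 'a::idom" and k :: nat
  defines "F \<equiv> [:- 1, 0, 1:] * pair_poly k u"
  shows "degree F = 2 * Suc k" and "i \<le> 2 * Suc k \<Longrightarrow> coeff F (2 * Suc k - i) = - coeff F i"
proof -
  have "pair_poly k u \<noteq> 0" by (auto simp: pair_poly_def)
  then show deg: "degree F = 2 * Suc k"
    unfolding F_def by (subst degree_mult_eq) (auto simp: degree_pair_poly)
  have "reflect_poly [:- 1, 0, 1 :: 'a:] = - [:- 1, 0, 1:]" by (simp add: reflect_poly_def)
  then have "reflect_poly F = - F"
    unfolding F_def reflect_poly_mult reflect_pair_poly by simp
  from arg_cong[OF this, of "\<lambda>p. coeff p i"]
  show "i \<le> 2 * Suc k \<Longrightarrow> coeff F (2 * Suc k - i) = - coeff F i"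
    by (simp add: coeff_reflect_poly deg)
qed

text \<open>Turns a palindromic polynomial into a parameter point: its coefficients from the middle
  one upwards are the parameters.\<close>

lemma sym_coeff_eq_band_coeff:
  fixes F :: "'a::comm_ring_1 poly"
  assumes deg: "degree F \<le> 2 * m" and sym: "\<And>i. i \<le> 2 * m \<Longrightarrow> coeff F (2 * m - i) = coeff F i"
  shows "sym_coeff m (\<lambda>j. coeff F (m + j)) = band_coeff m F"
proof
  fix s :: int
  consider "s < - int m" | "- int m \<le> s" "s < 0" | "0 \<le> s" "s \<le> int m" | "int m < s" by linarith
  then show "sym_coeff m (\<lambda>j. coeff F (m + j)) s = band_coeff m F s"
  proof cases
    case 2
    then have "2 * m - nat (s + int m) = m + nat \<bar>s\<bar>" "nat (s + int m) \<le> 2 * m" by auto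
    then show ?thesis using sym[of "nat (s + int m)"] 2 by (simp add: sym_coeff_def band_coeff_def)
  next
    case 3
    then have "nat (s + int m) = m + nat s" by auto
    then show ?thesis using 3 by (simp add: sym_coeff_def band_coeff_def)
  next
    case 4
    then have "degree F < nat (s + int m)" using deg by linarith
    then show ?thesis using 4 by (simp add: sym_coeff_def band_coeff_def coeff_eq_0)
  qed (auto simp: sym_coeff_def band_coeff_def)
qed

lemma skew_coeff_eq_band_coeff:
  fixes F :: "'a::{idom, ring_char_0} poly"
  assumes deg: "degree F \<le> 2 * m" and skew: "\<And>i. i \<le> 2 * m \<Longrightarrow> coeff F (2 * m - i) = - coeff F i"
  shows "skew_coeff m (\<lambda>j. coeff F (m + j)) = band_coeff m F"
proof
  fix s :: int
  consider "s < - int m" | "- int m \<le> s" "s < 0" | "s = 0" | "0 < s" "s \<le> int m" | "int m < s" by linarith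
  then show "skew_coeff m (\<lambda>j. coeff F (m + j)) s = band_coeff m F s"
  proof cases
    case 2
    then have "2 * m - nat (s + int m) = m + nat (- s)" "nat (s + int m) \<le> 2 * m" by auto
    then show ?thesis using skew[of "nat (s + int m)"] 2 by (simp add: skew_coeff_def band_coeff_def)
  next
    case 3
    \<comment> \<open>The middle coefficient is its own negative and vanishes in characteristic 0,
      in accordance with a vanishing diagonal.\<close>
    have "coeff F m = - coeff F m" using skew[of m] by simp
    then have "2 * coeff F m = 0" by (simp only: mult_2 eq_neg_iff_add_eq_0)
    then have "coeff F m = 0" by simp
    then show ?thesis using 3 by (simp add: skew_coeff_def band_coeff_def)
  next
    case 4
    then have "nat (s + int m) = m + nat s" by auto
    then show ?thesis using 4 by (simp add: skew_coeff_def band_coeff_def)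
  next
    case 5
    then have "degree F < nat (s + int m)" using deg by linarith
    then show ?thesis using 5 by (simp add: skew_coeff_def band_coeff_def coeff_eq_0)
  qed (auto simp: skew_coeff_def band_coeff_def)
qed

section \<open>Real points where the Hankel determinant does not vanish\<close>

lemma power_tower_mono: "j < l \<Longrightarrow> (2::real) ^ 3 ^ j < 2 ^ 3 ^ l"
  by (intro power_strict_increasing) auto

lemma power_tower_gt_1: "(1::real) < 2 ^ 3 ^ j"
  by (rule one_less_power) auto

lemma ex_sym_H_neq_0: "\<exists>a :: nat \<Rightarrow> real. sym_H m a \<noteq> 0"
proof -
  define r :: "nat \<Rightarrow> real" where "r j = 2 ^ 3 ^ j" for j
  define x where "x = sym_roots m r"
  define F where "F = pair_poly m (\<lambda>j. r j + inverse (r j))"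
  have r0: "r j \<noteq> 0" and r1: "1 < r j" and rmono: "j < l \<Longrightarrow> r j < r l" for j l
    using power_tower_gt_1[of j] power_tower_mono[of j l] by (auto simp: r_def)
  have inv1: "inverse (r j) < 1" "0 < inverse (r j)" for j
    using r1[of j] by (auto simp: inverse_less_1_iff)
  have tp: "ternary_prod m r t = 2 ^ t / (\<Prod>j<m. r j)" if "t < 3 ^ m" for t
    using ternary_prod_powers[OF that] by (simp add: r_def[abs_def])
  have tp_inj: "inj_on (ternary_prod m r) {t. t < 3 ^ m \<and> even t}"
    using r0 by (intro inj_onI) (auto simp: tp)
  have card: "card ((\<lambda>M. \<Prod>i\<in>M. x i) ` half_sets m) = (3 ^ m + 1) div 2"
    unfolding x_def sym_products_image[OF r0] by (simp add: card_image[OF tp_inj] card_even_less)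
  have mono: "strict_mono_on {..<2 * m} x"
  proof (rule strict_mono_onI)
    fix i l assume il: "i \<in> {..<2 * m}" "l \<in> {..<2 * m}" "i < l"
    consider "m \<le> i" | "i < m" "m \<le> l" | "l < m" by linarith
    then show "x i < x l"
    proof cases
      case 1
      then show ?thesis using il by (auto simp: x_def sym_roots_def intro!: rmono)
    next
      case 2
      then show ?thesis using inv1(1)[of "m - 1 - i"] r1[of "l - m"] by (simp add: x_def sym_roots_def)
    next
      case 3
      then have "r (m - 1 - l) < r (m - 1 - i)" using il by (intro rmono) auto
      moreover have "0 < r (m - 1 - l)" using r1[of "m - 1 - l"] by linarith
      ultimately show ?thesis using 3 il by (simp add: x_def sym_roots_def)
    qed
  qed
  have x0: "x i \<noteq> 0" for i using r0 by (simp add: x_def sym_roots_def)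
  have sums: "\<Sum>M = \<Sum>M'" if M: "M \<in> half_sets m" "M' \<in> half_sets m" "(\<Prod>i\<in>M. x i) = (\<Prod>i\<in>M'. x i)" for M M'
  proof (rule sym_pos.sum_positions_eqI)
    have "sym_pos.code m M \<in> {t. t < 3 ^ m \<and> even t}" "sym_pos.code m M' \<in> {t. t < 3 ^ m \<and> even t}"
      using sym_code_image M by blast+
    then show "sym_pos.code m M = sym_pos.code m M'"
      using M inj_onD[OF tp_inj] by (simp add: x_def prod_sym_roots r0)
  qed (use M in \<open>auto simp: half_sets_def\<close>)
  have "(\<Prod>i<2 * m. [:- x i, 1:]) = F"
    unfolding x_def F_def by (rule sym_roots_poly) (rule r0)
  moreover have "hankel_det (toeplitz_det (band_coeff m (\<Prod>i<2 * m. [:- x i, 1:])))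
      (card ((\<lambda>M. \<Prod>i\<in>M. x i) ` half_sets m)) \<noteq> 0"
    by (rule hankel_det_toeplitz_det_neq_0[OF mono x0 sums])
  ultimately have "hankel_det (toeplitz_det (band_coeff m F)) ((3 ^ m + 1) div 2) \<noteq> 0"
    by (simp only: card not_False_eq_True)
  moreover have "sym_coeff m (\<lambda>j. coeff F (m + j)) = band_coeff m F"
    by (rule sym_coeff_eq_band_coeff) (auto simp: F_def degree_pair_poly coeff_pair_poly_symmetric)
  ultimately have "sym_H m (\<lambda>j. coeff F (m + j)) \<noteq> 0"
    by (simp add: sym_H_def sym_D_def)
  then show ?thesis by blast
qed

lemma ex_skew_H_neq_0: "\<exists>a :: nat \<Rightarrow> real. skew_H (Suc k) a \<noteq> 0"
proof -
  define r :: "nat \<Rightarrow> real" where "r j = 2 ^ 3 ^ j" for j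
  define x where "x = skew_roots k r"
  define F where "F = [:- 1, 0, 1:] * pair_poly k (\<lambda>j. r j + inverse (r j))"
  define \<phi> where "\<phi> = (\<lambda>(b, t). (if b then - 1 else 1) * ternary_prod k r t)"
  have r0: "r j \<noteq> 0" and r1: "1 < r j" and rmono: "j < l \<Longrightarrow> r j < r l" for j l
    using power_tower_gt_1[of j] power_tower_mono[of j l] by (auto simp: r_def)
  have inv1: "inverse (r j) < 1" "0 < inverse (r j)" for j
    using r1[of j] by (auto simp: inverse_less_1_iff)
  have rprod: "0 < (\<Prod>j<k. r j)" by (rule prod_pos) (use r1 in \<open>auto intro: less_trans[of 0 1]\<close>)
  have tp: "ternary_prod k r t = 2 ^ t / (\<Prod>j<k. r j)" if "t < 3 ^ k" for t
    using ternary_prod_powers[OF that] by (simp add: r_def[abs_def])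
  have \<phi>_inj: "inj_on \<phi> (UNIV \<times> {..<3 ^ k})"
  proof (rule inj_onI)
    fix p q assume pq: "p \<in> UNIV \<times> {..<3 ^ k}" "q \<in> UNIV \<times> {..<3 ^ k}" "\<phi> p = \<phi> q"
    obtain b t c s where p: "p = (b, t)" and q: "q = (c, s)" by fastforce
    have "(if b then - 1 else 1) * (2::real) ^ t = (if c then - 1 else 1) * 2 ^ s"
      using pq rprod by (auto simp: p q \<phi>_def tp r0)
    moreover have "(2::real) ^ t > 0" "(2::real) ^ s > 0" by auto
    then have "(2::real) ^ t \<noteq> - (2 ^ s)" "- ((2::real) ^ t) \<noteq> 2 ^ s" by linarith+
    ultimately have "b = c \<and> (2::real) ^ t = 2 ^ s" by (auto split: if_splits)
    then show "p = q" by (simp add: p q)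
  qed
  have card: "card ((\<lambda>M. \<Prod>i\<in>M. x i) ` half_sets (Suc k)) = 2 * 3 ^ k"
    unfolding x_def skew_products_image[OF r0] using card_image[OF \<phi>_inj]
    by (simp add: \<phi>_def card_cartesian_product)
  have mono: "strict_mono_on {..<2 * Suc k} x"
  proof (rule strict_mono_onI)
    fix i l assume il: "i \<in> {..<2 * Suc k}" "l \<in> {..<2 * Suc k}" "i < l"
    have pos: "0 < r j" for j using r1[of j] by linarith
    have lt: "- 1 < r j" "- 1 < inverse (r j)" for j using pos[of j] inv1(2)[of j] by linarith+
    have mid: "inverse (r j) < r h" for j h using inv1(1)[of j] r1[of h] by linarith
    have "inverse (r (k - i)) < inverse (r (k - l))" if "l \<le> k" "0 < i"
      using rmono[of "k - l" "k - i"] that il(3) pos by simp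
    moreover have "r (i - Suc (Suc k)) < r (l - Suc (Suc k))" if "Suc k < i"
      using rmono that il(3) by simp
    ultimately show "x i < x l"
      using il lt mid inv1(1) r1 by (auto simp: x_def skew_roots_def)
  qed
  have x0: "x i \<noteq> 0" for i using r0 by (simp add: x_def skew_roots_def)
  have sums: "\<Sum>M = \<Sum>M'" if M: "M \<in> half_sets (Suc k)" "M' \<in> half_sets (Suc k)"
    "(\<Prod>i\<in>M. x i) = (\<Prod>i\<in>M'. x i)" for M M'
  proof (rule skew_pos.sum_positions_eqI)
    have sub: "M \<subseteq> {..<2 * Suc k}" "M' \<subseteq> {..<2 * Suc k}" and cards: "card M = Suc k" "card M' = Suc k"
      using M by (auto simp: half_sets_def)
    have "\<phi> (0 \<in> M, skew_pos.code k M) = \<phi> (0 \<in> M', skew_pos.code k M')"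
      using M by (simp add: x_def prod_skew_roots r0 \<phi>_def)
    then have eq: "(0 \<in> M) = (0 \<in> M')" "skew_pos.code k M = skew_pos.code k M'"
      using inj_onD[OF \<phi>_inj] skew_pos.code_less by (metis (no_types, lifting) UNIV_I SigmaI lessThan_iff prod.inject)+
    then show "skew_pos.code k M = skew_pos.code k M'" by simp
    \<comment> \<open>The product shows whether 0 is in M but is blind to \<open>Suc k\<close>,
      which carries the root 1; the parity of the cardinality recovers it.\<close>
    have "even (card (M \<inter> {0, Suc k})) = even (card (M' \<inter> {0, Suc k}))"
      using skew_pos.parity_code[OF sub(1)] skew_pos.parity_code[OF sub(2)] cards eq(2) by auto
    then show "M \<inter> {0, Suc k} = M' \<inter> {0, Suc k}"
      using eq(1) by (cases "0 \<in> M"; cases "Suc k \<in> M"; cases "Suc k \<in> M'") (auto simp: Int_insert_right)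
  qed (use M in \<open>auto simp: half_sets_def\<close>)
  have "(\<Prod>i<2 * Suc k. [:- x i, 1:]) = F"
    unfolding x_def F_def by (rule skew_roots_poly) (rule r0)
  moreover have "hankel_det (toeplitz_det (band_coeff (Suc k) (\<Prod>i<2 * Suc k. [:- x i, 1:])))
      (card ((\<lambda>M. \<Prod>i\<in>M. x i) ` half_sets (Suc k))) \<noteq> 0"
    by (rule hankel_det_toeplitz_det_neq_0[OF mono x0 sums])
  ultimately have "hankel_det (toeplitz_det (band_coeff (Suc k) F)) (2 * 3 ^ k) \<noteq> 0"
    by (simp only: card not_False_eq_True)
  moreover have "skew_coeff (Suc k) (\<lambda>j. coeff F (Suc k + j)) = band_coeff (Suc k) F"
    by (rule skew_coeff_eq_band_coeff) (auto simp: F_def coeff_skew_pair_poly simp del: mult_pCons_left mult_Suc_right)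
  ultimately have "skew_H (Suc k) (\<lambda>j. coeff F (Suc k + j)) \<noteq> 0"
    by (simp add: skew_H_def skew_D_def)
  then show ?thesis by blast
qed

section \<open>Vanishing of the Hankel minors at all parameter points\<close>

text \<open>A minor is a polynomial in the coefficients of the symbol, so its vanishing for small
  nonzero t passes to the limit.\<close>

lemma minors_vanish_limit:
  fixes f :: "complex \<Rightarrow> complex poly"
  assumes lim: "\<And>k. ((\<lambda>t. coeff (f t) k) \<longlongrightarrow> coeff g k) (at 0)"
    and ev: "\<forall>\<^sub>F t in at 0. minors_vanish d (toeplitz_det (band_coeff m (f t)))"
  shows "minors_vanish d (toeplitz_det (band_coeff m g))"
  unfolding minors_vanish_def
proof
  fix p
  let ?M = "\<lambda>h. det (mat (Suc d) (Suc d) (\<lambda>(i, j). toeplitz_det (band_coeff m h) (p i + j)))"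
  have "((\<lambda>t. ?M (f t)) \<longlongrightarrow> ?M g) (at 0)"
    by (intro tendsto_det_mat) (auto intro!: tendsto_toeplitz_det simp: band_coeff_def lim)
  moreover have "((\<lambda>t. ?M (f t)) \<longlongrightarrow> 0) (at 0)"
    by (rule tendsto_eventually) (use ev in \<open>auto elim!: eventually_mono simp: minors_vanish_def\<close>)
  ultimately show "?M g = 0"
    by (rule tendsto_unique[rotated]) simp
qed

lemma tendsto_coeff_mult:
  fixes p q :: "'b \<Rightarrow> complex poly"
  assumes "\<And>k. ((\<lambda>t. coeff (p t) k) \<longlongrightarrow> coeff p0 k) F" "\<And>k. ((\<lambda>t. coeff (q t) k) \<longlongrightarrow> coeff q0 k) F"
  shows "((\<lambda>t. coeff (p t * q t) k) \<longlongrightarrow> coeff (p0 * q0) k) F"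
  unfolding coeff_mult by (intro tendsto_sum tendsto_mult assms)

lemma tendsto_coeff_pair_poly:
  fixes u :: "'b \<Rightarrow> nat \<Rightarrow> complex"
  assumes "\<And>j. ((\<lambda>t. u t j) \<longlongrightarrow> v j) F"
  shows "((\<lambda>t. coeff (pair_poly n (u t)) k) \<longlongrightarrow> coeff (pair_poly n v) k) F"
proof (induction n arbitrary: k)
  case (Suc n)
  have "((\<lambda>t. coeff [:1, - u t n, 1:] k) \<longlongrightarrow> coeff [:1, - v n, 1:] k) F" for k
    using tendsto_minus[OF assms[of n]] by (auto simp: coeff_pCons split: nat.split)
  with Suc show ?case
    unfolding pair_poly_def prod.lessThan_Suc by (intro tendsto_coeff_mult) auto
qed (simp add: pair_poly_def)

section \<open>Vanishing minors for products of pairs\<close>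

lemma ex_inverse_pair: "\<exists>r :: complex. r \<noteq> 0 \<and> r + inverse r = u"
proof -
  \<comment> \<open>A solution of r^2 - u r + 1 = 0; the other one is u - r.\<close>
  define r where "r = (u + csqrt (u\<^sup>2 - 4)) / 2"
  have "(csqrt (u\<^sup>2 - 4))\<^sup>2 = u\<^sup>2 - 4" by simp
  then have "r * (u - r) = 1"
    by (simp add: r_def field_simps power2_eq_square)
  then have "r \<noteq> 0" "inverse r = u - r"
    by (auto intro: inverse_unique)
  then show ?thesis by (intro exI[of _ r]) simp
qed

lemma ex_inverse_pairs:
  fixes u :: "nat \<Rightarrow> complex"
  assumes ne: "\<And>j. j < n \<Longrightarrow> u j \<noteq> 2 \<and> u j \<noteq> - 2"
  shows "\<exists>r. (\<forall>j. r j \<noteq> 0 \<and> r j + inverse (r j) = u j) \<and> (\<forall>j<n. r j ^ 2 \<noteq> 1)"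
proof -
  have "\<forall>j. \<exists>r. r \<noteq> 0 \<and> r + inverse r = u j"
    using ex_inverse_pair by blast
  then obtain r where r: "\<forall>j. r j \<noteq> 0 \<and> r j + inverse (r j) = u j"
    by metis
  have "r j ^ 2 \<noteq> 1" if "j < n" for j
  proof
    assume "r j ^ 2 = 1"
    then have "r j = 1 \<or> r j = - 1" by (simp add: power2_eq_1_iff)
    then show False using spec[OF r, of j] ne[OF that] by auto
  qed
  with r show ?thesis by blast
qed

text \<open>Distinct values \<open>u j\<close> other than 2 and -2 give 2m distinct roots, and the
  products over half of them are indexed by the even codes.\<close>

lemma minors_vanish_sym_distinct:
  fixes u :: "nat \<Rightarrow> complex"
  assumes inj: "inj_on u {..<m}" and ne: "\<And>j. j < m \<Longrightarrow> u j \<noteq> 2 \<and> u j \<noteq> - 2"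
  shows "minors_vanish ((3 ^ m + 1) div 2) (toeplitz_det (band_coeff m (smult c (pair_poly m u))))"
proof -
  obtain r where "(\<forall>j. r j \<noteq> 0 \<and> r j + inverse (r j) = u j) \<and> (\<forall>j<m. r j ^ 2 \<noteq> 1)"
    using ex_inverse_pairs[of m u, OF ne] by blast
  then have r: "r j \<noteq> 0" "r j + inverse (r j) = u j" "j < m \<Longrightarrow> r j ^ 2 \<noteq> 1" for j
    by auto
  have poly: "pair_poly m u = (\<Prod>i<2 * m. [:- sym_roots m r i, 1:])"
    by (subst sym_roots_poly) (auto simp: r)
  show ?thesis
  proof (rule minors_vanish_toeplitz_det)
    show "degree (smult c (pair_poly m u)) \<le> 2 * m"
      using degree_smult_le[of c "pair_poly m u"] by (simp add: degree_pair_poly)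
    show "poly (smult c (pair_poly m u)) (sym_roots m r i) = 0" if "i < 2 * m" for i
      using that by (auto simp: poly poly_prod intro!: prod_zero)
    show "inj_on (sym_roots m r) {..<2 * m}"
      by (rule sym_pos.inj_on_roots[of m _ r]) (auto simp: r inj)
    show "card ((\<lambda>M. \<Prod>i\<in>M. sym_roots m r i) ` half_sets m) \<le> (3 ^ m + 1) div 2"
      unfolding sym_products_image[OF r(1)] card_even_less[symmetric]
      by (rule card_image_le) (auto intro: finite_subset[of _ "{..<3 ^ m}"])
  qed
qed

lemma minors_vanish_skew_distinct:
  fixes u :: "nat \<Rightarrow> complex"
  assumes inj: "inj_on u {..<k}" and ne: "\<And>j. j < k \<Longrightarrow> u j \<noteq> 2 \<and> u j \<noteq> - 2"
  shows "minors_vanish (2 * 3 ^ k)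
    (toeplitz_det (band_coeff (Suc k) (smult c ([:- 1, 0, 1:] * pair_poly k u))))"
proof -
  obtain r where "(\<forall>j. r j \<noteq> 0 \<and> r j + inverse (r j) = u j) \<and> (\<forall>j<k. r j ^ 2 \<noteq> 1)"
    using ex_inverse_pairs[of k u, OF ne] by blast
  then have r: "r j \<noteq> 0" "r j + inverse (r j) = u j" "j < k \<Longrightarrow> r j ^ 2 \<noteq> 1" for j
    by auto
  have poly: "[:- 1, 0, 1:] * pair_poly k u = (\<Prod>i<2 * Suc k. [:- skew_roots k r i, 1:])"
    by (subst skew_roots_poly) (auto simp: r)
  show ?thesis
  proof (rule minors_vanish_toeplitz_det)
    show "degree (smult c ([:- 1, 0, 1:] * pair_poly k u)) \<le> 2 * Suc k"
      using degree_smult_le[of c "[:- 1, 0, 1:] * pair_poly k u"] coeff_skew_pair_poly(1)[of k u] by linarith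
    show "poly (smult c ([:- 1, 0, 1:] * pair_poly k u)) (skew_roots k r i) = 0" if "i < 2 * Suc k" for i
      unfolding poly poly_smult poly_prod using that by (intro mult_eq_0_iff[THEN iffD2] disjI2 prod_zero) auto
    show "inj_on (skew_roots k r) {..<2 * Suc k}"
      by (rule skew_pos.inj_on_roots[of k _ r]) (auto simp: r inj)
    have "card ((\<lambda>M. \<Prod>i\<in>M. skew_roots k r i) ` half_sets (Suc k)) \<le> card ((UNIV :: bool set) \<times> {..<(3::nat) ^ k})"
      unfolding skew_products_image[OF r(1)] by (rule card_image_le) simp
    then show "card ((\<lambda>M. \<Prod>i\<in>M. skew_roots k r i) ` half_sets (Suc k)) \<le> 2 * 3 ^ k"
      by (simp add: card_cartesian_product)
  qed
qed

text \<open>The values move with distinct nonzero speeds j + 1, so each of the finitely many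
  forbidden coincidences happens for a single t only.\<close>

lemma eventually_perturbation_distinct:
  fixes u :: "nat \<Rightarrow> complex"
  shows "\<forall>\<^sub>F t in at 0. inj_on (\<lambda>j. u j + of_nat (Suc j) * t) {..<n} \<and>
    (\<forall>j<n. u j + of_nat (Suc j) * t \<noteq> 2 \<and> u j + of_nat (Suc j) * t \<noteq> - 2)"
proof -
  have "\<forall>\<^sub>F t in at 0. u j + of_nat (Suc j) * t \<noteq> u l + of_nat (Suc l) * t" if "j \<noteq> l" for j l
  proof (rule eventually_mono[OF eventually_neq_at_within])
    fix t assume t: "t \<noteq> (u l - u j) / (of_nat (Suc j) - of_nat (Suc l))"
    have "(of_nat (Suc j) - of_nat (Suc l) :: complex) \<noteq> 0" using that by simp
    then show "u j + of_nat (Suc j) * t \<noteq> u l + of_nat (Suc l) * t"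
      using t by (auto simp: eq_divide_eq algebra_simps)
  qed
  then have "\<forall>\<^sub>F t in at 0. \<forall>j\<in>{..<n}. \<forall>l\<in>{..<n}. j \<noteq> l \<longrightarrow> u j + of_nat (Suc j) * t \<noteq> u l + of_nat (Suc l) * t"
    by (intro eventually_ball_finite ballI) auto
  moreover have "\<forall>\<^sub>F t in at 0. u j + of_nat (Suc j) * t \<noteq> c" for j c
  proof (rule eventually_mono[OF eventually_neq_at_within])
    fix t assume t: "t \<noteq> (c - u j) / of_nat (Suc j)"
    have "(of_nat (Suc j) :: complex) \<noteq> 0" by (rule of_nat_neq_0)
    then show "u j + of_nat (Suc j) * t \<noteq> c"
      using t by (auto simp: eq_divide_eq algebra_simps simp del: of_nat_Suc)
  qed
  then have "\<forall>\<^sub>F t in at 0. \<forall>j\<in>{..<n}. u j + of_nat (Suc j) * t \<noteq> 2 \<and> u j + of_nat (Suc j) * t \<noteq> - 2"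
    by (intro eventually_ball_finite ballI eventually_conj) auto
  ultimately show ?thesis
    by eventually_elim (auto simp: inj_on_def)
qed

lemma tendsto_perturbation:
  fixes u :: "nat \<Rightarrow> complex"
  shows "((\<lambda>t. u j + of_nat (Suc j) * t) \<longlongrightarrow> u j) (at 0)"
  by (rule tendsto_eq_intros refl)+ simp

lemma minors_vanish_sym_pair_poly:
  fixes u :: "nat \<Rightarrow> complex"
  shows "minors_vanish ((3 ^ m + 1) div 2) (toeplitz_det (band_coeff m (smult c (pair_poly m u))))"
proof (rule minors_vanish_limit)
  let ?u = "\<lambda>t j. u j + of_nat (Suc j) * t"
  show "((\<lambda>t. coeff (smult c (pair_poly m (?u t))) k) \<longlongrightarrow> coeff (smult c (pair_poly m u)) k) (at 0)" for k
    unfolding coeff_smult by (intro tendsto_mult tendsto_const tendsto_coeff_pair_poly tendsto_perturbation)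
  show "\<forall>\<^sub>F t in at 0. minors_vanish ((3 ^ m + 1) div 2) (toeplitz_det (band_coeff m (smult c (pair_poly m (?u t)))))"
    using eventually_perturbation_distinct[of u m]
    by (rule eventually_mono) (intro minors_vanish_sym_distinct; blast)
qed

lemma minors_vanish_skew_pair_poly:
  fixes u :: "nat \<Rightarrow> complex"
  shows "minors_vanish (2 * 3 ^ k)
    (toeplitz_det (band_coeff (Suc k) (smult c ([:- 1, 0, 1:] * pair_poly k u))))"
proof (rule minors_vanish_limit)
  let ?u = "\<lambda>t j. u j + of_nat (Suc j) * t"
  show "((\<lambda>t. coeff (smult c ([:- 1, 0, 1:] * pair_poly k (?u t))) i) \<longlongrightarrow>
      coeff (smult c ([:- 1, 0, 1:] * pair_poly k u)) i) (at 0)" for i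
    unfolding coeff_smult
    by (intro tendsto_mult tendsto_const tendsto_coeff_mult tendsto_coeff_pair_poly tendsto_perturbation)
  show "\<forall>\<^sub>F t in at 0. minors_vanish (2 * 3 ^ k)
      (toeplitz_det (band_coeff (Suc k) (smult c ([:- 1, 0, 1:] * pair_poly k (?u t)))))"
    using eventually_perturbation_distinct[of u k]
    by (rule eventually_mono) (intro minors_vanish_skew_distinct; blast)
qed

section \<open>From arbitrary coefficients to products of pairs\<close>

text \<open>For \<open>c = 2\<close> these are the Chebyshev polynomials expressing \<open>z\<^sup>j + z\<^sup>-\<^sup>j\<close> by \<open>z + 1/z\<close>;
  for \<open>c = 1\<close> those expressing \<open>z\<^sup>j\<^sup>+\<^sup>1 - z\<^sup>-\<^sup>j\<^sup>-\<^sup>1\<close> divided by \<open>z - 1/z\<close>.\<close>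
fun chebyshev :: "'a::comm_ring_1 \<Rightarrow> nat \<Rightarrow> 'a poly" where
  "chebyshev c 0 = [:c:]"
| "chebyshev c (Suc 0) = [:0, 1:]"
| "chebyshev c (Suc (Suc j)) = pCons 0 (chebyshev c (Suc j)) - chebyshev c j"

lemma degree_chebyshev_le: "degree (chebyshev c j) \<le> j"
  by (induction c j rule: chebyshev.induct)
    (auto intro!: degree_diff_le order.trans[OF degree_pCons_le])

text \<open>Index 0 is left out, since the leading coefficient there is \<open>c\<close>.\<close>

lemma coeff_chebyshev: "coeff (chebyshev c (Suc j)) (Suc j) = 1"
proof (induction c "Suc j" arbitrary: j rule: chebyshev.induct)
  case (3 c j)
  have "coeff (chebyshev c j) (Suc (Suc j)) = 0"
    using degree_chebyshev_le[of c j] by (intro coeff_eq_0) simp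
  with 3 show ?case by simp
qed simp

lemma chebyshev_2:
  fixes z :: complex
  assumes "z \<noteq> 0"
  shows "poly (chebyshev 2 j) (z + inverse z) = z ^ j + inverse z ^ j"
proof (induction "2::complex" j rule: chebyshev.induct)
  case (3 j)
  then show ?case using assms by (simp add: field_simps)
qed simp_all

text \<open>The multiplied form also covers z = 1 and z = -1, where z - 1/z vanishes.\<close>

lemma chebyshev_1:
  fixes z :: complex
  assumes "z \<noteq> 0"
  shows "(z - inverse z) * poly (chebyshev 1 j) (z + inverse z) = z ^ Suc j - inverse z ^ Suc j"
proof (induction "1::complex" j rule: chebyshev.induct)
  case 2
  then show ?case using assms by (simp add: field_simps power2_eq_square)
next
  case (3 j)
  have "(z - inverse z) * poly (chebyshev 1 (Suc (Suc j))) (z + inverse z) =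
      (z + inverse z) * ((z - inverse z) * poly (chebyshev 1 (Suc j)) (z + inverse z)) -
      (z - inverse z) * poly (chebyshev 1 j) (z + inverse z)"
    by (simp add: algebra_simps)
  also have "\<dots> = z ^ Suc (Suc (Suc j)) - inverse z ^ Suc (Suc (Suc j))"
    unfolding 3 using assms by (simp add: field_simps)
  finally show ?case .
qed simp_all

text \<open>A factor z in front of the difference takes care of the exceptional point 0.\<close>

lemma poly_eqI_nonzero:
  fixes p q :: "complex poly"
  assumes "\<And>z. z \<noteq> 0 \<Longrightarrow> poly p z = poly q z"
  shows "p = q"
proof -
  have "poly ([:0, 1:] * (p - q)) z = 0" for z
    using assms[of z] by (cases "z = 0") auto
  then have "[:0, 1:] * (p - q) = 0" using poly_all_0_iff_0 by blast
  then show ?thesis by simp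
qed

text \<open>Over the complex numbers \<open>g\<close> splits into n linear factors, and a factor z
  turns each z + 1/z - x into z^2 - x z + 1. So the roots of \<open>g\<close> serve as the
  parameters of the pair polynomial; Q carries the remaining roots.\<close>

lemma inverse_symmetric_factorization:
  fixes F Q g :: "complex poly"
  assumes deg: "degree g \<le> n" and lead: "coeff g n = c" "c \<noteq> 0"
    and F: "\<And>z. z \<noteq> 0 \<Longrightarrow> poly F z = poly Q z * z ^ n * poly g (z + inverse z)"
  shows "\<exists>u. F = smult c (Q * pair_poly n u)"
proof -
  have g: "degree g = n" "g \<noteq> 0" using deg lead le_degree[of g n] by auto
  obtain A where A: "size A = n" "g = smult c (\<Prod>x\<in>#A. [:- x, 1:])"
    using alg_closed_imp_factorization[OF g(2)] g(1) lead(1) by auto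
  obtain xs where xs: "A = mset xs" using ex_mset by metis
  have len: "length xs = n" using A(1) xs by simp
  have g_eq: "g = smult c (\<Prod>j<n. [:- (xs ! j), 1:])"
    unfolding A(2) xs by (simp add: prod_mset_prod_list prod.list_conv_set_nth len atLeast0LessThan flip: mset_map)
  have "F = smult c (Q * pair_poly n ((!) xs))"
  proof (rule poly_eqI_nonzero)
    fix z :: complex assume z: "z \<noteq> 0"
    have "poly g (z + inverse z) = c * (\<Prod>j<n. z + inverse z - xs ! j)"
      by (simp add: g_eq poly_prod)
    then have "z ^ n * poly g (z + inverse z) = c * (\<Prod>j<n. z * (z + inverse z - xs ! j))"
      by (simp only: prod.distrib prod_constant card_lessThan mult.left_commute)
    also have "(\<Prod>j<n. z * (z + inverse z - xs ! j)) = poly (pair_poly n ((!) xs)) z"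
      using z by (simp add: pair_poly_def poly_prod algebra_simps)
    finally show "poly F z = poly (smult c (Q * pair_poly n ((!) xs))) z"
      using F[OF z] by (simp add: mult_ac)
  qed
  then show ?thesis by blast
qed

text \<open>The polynomial z^m times the Laurent series of \<open>b\<close>, inverse to
  \<open>band_coeff\<close> on sequences supported in [-m, m].\<close>

definition band_poly :: "nat \<Rightarrow> (int \<Rightarrow> 'a::comm_ring_1) \<Rightarrow> 'a poly" where
  "band_poly m b = (\<Sum>i\<le>2 * m. monom (b (int i - int m)) i)"

lemma coeff_band_poly: "coeff (band_poly m b) i = (if i \<le> 2 * m then b (int i - int m) else 0)"
  by (simp add: band_poly_def coeff_sum)

lemma band_coeff_band_poly:
  assumes "\<And>s. \<bar>s\<bar> > int m \<Longrightarrow> b s = 0"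
  shows "band_coeff m (band_poly m b) = b"
proof
  fix s
  show "band_coeff m (band_poly m b) s = b s"
    using assms[of s] by (auto simp: band_coeff_def coeff_band_poly nat_le_iff)
qed

lemma sum_around_middle:
  fixes h :: "nat \<Rightarrow> 'a::comm_monoid_add"
  shows "(\<Sum>i\<le>2 * m. h i) = h m + (\<Sum>j<m. h (m + Suc j) + h (m - Suc j))"
proof -
  have split: "(\<Sum>i<m + n. h i) = (\<Sum>i<m. h i) + (\<Sum>i<n. h (m + i))" for n
    by (induction n) (auto simp: add.assoc)
  have "{..2 * m} = {..<m + Suc m}" by auto
  then have "(\<Sum>i\<le>2 * m. h i) = (\<Sum>i<m. h i) + (\<Sum>i<Suc m. h (m + i))"
    using split[of "Suc m"] by simp
  also have "(\<Sum>i<Suc m. h (m + i)) = h m + (\<Sum>i<m. h (m + Suc i))"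
    by (subst sum.lessThan_Suc_shift) simp
  also have "(\<Sum>i<m. h i) = (\<Sum>j<m. h (m - Suc j))"
    by (rule sum.nat_diff_reindex[symmetric])
  finally show ?thesis by (simp add: sum.distrib add_ac)
qed

lemma poly_band_poly:
  fixes z :: complex
  assumes z: "z \<noteq> 0"
  shows "poly (band_poly m b) z = z ^ m * (b 0 + (\<Sum>j<m. b (int (Suc j)) * z ^ Suc j + b (- int (Suc j)) * inverse z ^ Suc j))"
proof -
  have eval: "poly (band_poly m b) z = (\<Sum>i\<le>2 * m. b (int i - int m) * z ^ i)"
    by (simp only: band_poly_def poly_sum poly_monom)
  have "poly (band_poly m b) z = b 0 * z ^ m + (\<Sum>j<m. b (int (Suc j)) * z ^ (m + Suc j) + b (- int (Suc j)) * z ^ (m - Suc j))"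
    unfolding eval sum_around_middle
    by (intro arg_cong2[where f = "(+)"] sum.cong) (auto intro!: arg_cong[of _ _ b])
  also have "\<dots> = b 0 * z ^ m + (\<Sum>j<m. z ^ m * (b (int (Suc j)) * z ^ Suc j + b (- int (Suc j)) * inverse z ^ Suc j))"
  proof (intro arg_cong2[where f = "(+)"] sum.cong refl)
    fix j assume "j \<in> {..<m}"
    then have "z ^ m = z ^ (m - Suc j) * z ^ Suc j" by (simp only: power_add[symmetric]) simp
    then have "z ^ m * inverse z ^ Suc j = z ^ (m - Suc j)"
      using z by (simp add: power_inverse field_simps)
    then show "b (int (Suc j)) * z ^ (m + Suc j) + b (- int (Suc j)) * z ^ (m - Suc j) =
        z ^ m * (b (int (Suc j)) * z ^ Suc j + b (- int (Suc j)) * inverse z ^ Suc j)"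
      by (simp only: power_add distrib_left mult.left_commute[of "z ^ m"])
  qed
  finally show ?thesis by (simp only: distrib_left sum_distrib_left mult_ac)
qed

text \<open>The symbol is z^m times a polynomial \<open>g\<close> in z + 1/z. Only the last
  Chebyshev polynomial reaches degree m, and it is monic, so \<open>g\<close> has leading
  coefficient \<open>a m\<close>.\<close>

lemma sym_band_poly_factorization:
  fixes a :: "nat \<Rightarrow> complex"
  assumes m: "m \<ge> 1" and am: "a m \<noteq> 0"
  shows "\<exists>u. band_poly m (sym_coeff m a) = smult (a m) (pair_poly m u)"
proof -
  define g where "g = [:a 0:] + (\<Sum>j<m. smult (a (Suc j)) (chebyshev 2 (Suc j)))"
  obtain k where k: "m = Suc k" using m by (cases m) auto
  have deg_le: "degree (smult (a (Suc j)) (chebyshev 2 (Suc j))) \<le> Suc j" for j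
    using degree_smult_le degree_chebyshev_le by (rule order.trans)
  have "degree g \<le> m"
    unfolding g_def by (intro degree_add_le degree_sum_le order.trans[OF deg_le]) auto
  moreover have "coeff g m = a m"
  proof -
    have "coeff (chebyshev 2 (Suc j)) (Suc k) = (0::complex)" if "j < k" for j
      using that degree_chebyshev_le[of "2::complex" "Suc j"] by (intro coeff_eq_0) simp
    then show ?thesis by (simp add: g_def k coeff_sum coeff_chebyshev)
  qed
  moreover have "poly (band_poly m (sym_coeff m a)) z = poly 1 z * z ^ m * poly g (z + inverse z)" if "z \<noteq> 0" for z
  proof -
    have "poly g (z + inverse z) = a 0 + (\<Sum>j<m. a (Suc j) * (z ^ Suc j + inverse z ^ Suc j))"
      using that by (simp add: g_def poly_sum chebyshev_2 del: power_Suc)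
    moreover have "sym_coeff m a 0 = a 0" by (simp add: sym_coeff_def)
    moreover have "sym_coeff m a (int (Suc j)) = a (Suc j)" "sym_coeff m a (- int (Suc j)) = a (Suc j)" if "j < m" for j
      using that by (auto simp: sym_coeff_def nat_eq_iff simp del: of_nat_Suc)
    ultimately show ?thesis
      using that by (simp add: poly_band_poly distrib_left del: of_nat_Suc power_Suc)
  qed
  ultimately show ?thesis
    using inverse_symmetric_factorization[of g m "a m" "band_poly m (sym_coeff m a)" 1] am by simp
qed

lemma skew_band_poly_factorization:
  fixes a :: "nat \<Rightarrow> complex"
  assumes am: "a (Suc k) \<noteq> 0"
  shows "\<exists>u. band_poly (Suc k) (skew_coeff (Suc k) a) = smult (a (Suc k)) ([:- 1, 0, 1:] * pair_poly k u)"
proof (rule inverse_symmetric_factorization)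
  define g where "g = (\<Sum>j<Suc k. smult (a (Suc j)) (chebyshev 1 j))"
  have deg_le: "degree (smult (a (Suc j)) (chebyshev 1 j)) \<le> j" for j
    using degree_smult_le degree_chebyshev_le by (rule order.trans)
  show "degree g \<le> k"
    unfolding g_def by (intro degree_sum_le order.trans[OF deg_le]) auto
  show "coeff g k = a (Suc k)"
  proof -
    have "coeff (chebyshev 1 j) k = (0::complex)" if "j < k" for j
      using that degree_chebyshev_le[of "1::complex" j] by (intro coeff_eq_0) simp
    moreover have "coeff (chebyshev 1 k) k = (1::complex)"
      by (cases k) (auto simp: coeff_chebyshev)
    ultimately show ?thesis by (simp add: g_def coeff_sum)
  qed
  show "poly (band_poly (Suc k) (skew_coeff (Suc k) a)) z =
      poly [:- 1, 0, 1:] z * z ^ k * poly g (z + inverse z)" if z: "z \<noteq> 0" for z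
  proof -
    have "skew_coeff (Suc k) a (int (Suc j)) = a (Suc j)" "skew_coeff (Suc k) a (- int (Suc j)) = - a (Suc j)"
      if "j < Suc k" for j
      using that by (auto simp: skew_coeff_def nat_eq_iff simp del: of_nat_Suc)
    moreover have "skew_coeff (Suc k) a 0 = 0" by (simp add: skew_coeff_def)
    ultimately have "poly (band_poly (Suc k) (skew_coeff (Suc k) a)) z =
        z ^ Suc k * (\<Sum>j<Suc k. a (Suc j) * (z ^ Suc j - inverse z ^ Suc j))"
      using z by (simp add: poly_band_poly right_diff_distrib del: of_nat_Suc power_Suc sum.lessThan_Suc)
    also have "\<dots> = z ^ Suc k * (\<Sum>j<Suc k. a (Suc j) * ((z - inverse z) * poly (chebyshev 1 j) (z + inverse z)))"
      by (simp only: chebyshev_1[OF z])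
    \<comment> \<open>One factor z is split off from \<open>z ^ Suc k\<close> to turn z - 1/z into
      the polynomial z^2 - 1.\<close>
    also have "\<dots> = z ^ k * (z * (z - inverse z)) * poly g (z + inverse z)"
      by (simp add: g_def poly_sum sum_distrib_left mult_ac del: sum.lessThan_Suc)
    also have "z * (z - inverse z) = poly [:- 1, 0, 1:] z"
      using z by (simp add: field_simps)
    finally show ?thesis by (simp only: mult_ac)
  qed
qed (rule am)

text \<open>The factorization is available if \<open>a m\<close> is nonzero; a point with
  \<open>a m = 0\<close> is the limit of the points \<open>a(m := t)\<close> with t nonzero.\<close>

lemma minors_vanish_sym_D:
  fixes a :: "nat \<Rightarrow> complex"
  assumes m: "m \<ge> 1"
  shows "minors_vanish ((3 ^ m + 1) div 2) (sym_D m a)"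
proof -
  have band: "band_coeff m (band_poly m (sym_coeff m b)) = sym_coeff m b" for b :: "nat \<Rightarrow> complex"
    by (rule band_coeff_band_poly) (auto simp: sym_coeff_def)
  have nz: "minors_vanish ((3 ^ m + 1) div 2) (toeplitz_det (band_coeff m (band_poly m (sym_coeff m b))))"
    if "b m \<noteq> 0" for b :: "nat \<Rightarrow> complex"
    using sym_band_poly_factorization[of m b, OF m that] minors_vanish_sym_pair_poly by metis
  have "minors_vanish ((3 ^ m + 1) div 2) (toeplitz_det (band_coeff m (band_poly m (sym_coeff m a))))"
  proof (cases "a m = 0")
    case True
    have lim: "((\<lambda>t. (a(m := t)) j) \<longlongrightarrow> a j) (at 0)" for j
      using True by (cases "j = m") simp_all
    show ?thesis
    proof (rule minors_vanish_limit)
      show "((\<lambda>t. coeff (band_poly m (sym_coeff m (a(m := t)))) k) \<longlongrightarrow> coeff (band_poly m (sym_coeff m a)) k) (at 0)" for k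
        by (auto simp: coeff_band_poly sym_coeff_def simp del: fun_upd_apply intro!: tendsto_minus lim)
      show "\<forall>\<^sub>F t in at 0. minors_vanish ((3 ^ m + 1) div 2)
          (toeplitz_det (band_coeff m (band_poly m (sym_coeff m (a(m := t))))))"
        by (rule eventually_mono[OF eventually_neq_at_within[of 0]], rule nz) simp
    qed
  qed (rule nz)
  then show ?thesis by (simp add: band sym_D_def)
qed

lemma minors_vanish_skew_D:
  fixes a :: "nat \<Rightarrow> complex"
  shows "minors_vanish (2 * 3 ^ k) (skew_D (Suc k) a)"
proof -
  let ?m = "Suc k"
  have band: "band_coeff ?m (band_poly ?m (skew_coeff ?m b)) = skew_coeff ?m b" for b :: "nat \<Rightarrow> complex"
    by (rule band_coeff_band_poly) (auto simp: skew_coeff_def)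
  have nz: "minors_vanish (2 * 3 ^ k) (toeplitz_det (band_coeff ?m (band_poly ?m (skew_coeff ?m b))))"
    if "b ?m \<noteq> 0" for b :: "nat \<Rightarrow> complex"
    using skew_band_poly_factorization[of b k, OF that] minors_vanish_skew_pair_poly by metis
  have "minors_vanish (2 * 3 ^ k) (toeplitz_det (band_coeff ?m (band_poly ?m (skew_coeff ?m a))))"
  proof (cases "a ?m = 0")
    case True
    have lim: "((\<lambda>t. (a(?m := t)) j) \<longlongrightarrow> a j) (at 0)" for j
      using True by (cases "j = ?m") simp_all
    show ?thesis
    proof (rule minors_vanish_limit)
      show "((\<lambda>t. coeff (band_poly ?m (skew_coeff ?m (a(?m := t)))) i) \<longlongrightarrow> coeff (band_poly ?m (skew_coeff ?m a)) i) (at 0)" for i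
        by (auto simp: coeff_band_poly skew_coeff_def simp del: fun_upd_apply intro!: tendsto_minus lim)
      show "\<forall>\<^sub>F t in at 0. minors_vanish (2 * 3 ^ k)
          (toeplitz_det (band_coeff ?m (band_poly ?m (skew_coeff ?m (a(?m := t))))))"
        by (rule eventually_mono[OF eventually_neq_at_within[of 0]], rule nz) simp
    qed
  qed (rule nz)
  then show ?thesis by (simp add: band skew_D_def)
qed

section \<open>Generic recurrence degrees\<close>

lemma min_recurrence_degreeI:
  assumes "minors_vanish d u" "hankel_det u d \<noteq> 0"
  shows "min_recurrence_degree u d"
  unfolding min_recurrence_degree_def
proof (intro conjI allI impI)
  show "satisfies_recurrence u d"
    by (rule satisfies_recurrence_if_minors_eq_0) (use assms in \<open>simp_all add: minors_vanish_def\<close>)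
  show "d \<le> d'" if "satisfies_recurrence u d'" for d'
    using hankel_det_eq_0_if_recurrence[OF that] assms(2) not_le by blast
qed

theorem theorem3p16:
  fixes m :: nat
  assumes "m \<ge> 1"
  shows
    "(poly_vars (sym_H m indet) \<subseteq> {0..m} \<and>
      sym_H m indet \<noteq> 0 \<and>
      (\<forall>a :: nat \<Rightarrow> complex. poly_eval a (sym_H m indet) = sym_H m a) \<and>
      (\<forall>a :: nat \<Rightarrow> complex. sym_H m a \<noteq> 0 \<longrightarrow>
         min_recurrence_degree (sym_D m a) ((3 ^ m + 1) div 2)) \<and>
      {a :: nat \<Rightarrow> complex. \<exists>d' < (3 ^ m + 1) div 2. min_recurrence_degree (sym_D m a) d'}
        \<subseteq> {a. sym_H m a = 0} \<and>
      {a :: nat \<Rightarrow> complex. sym_H m a = 0} \<subset> UNIV)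
     \<and>
     (poly_vars (skew_H m indet) \<subseteq> {1..m} \<and>
      skew_H m indet \<noteq> 0 \<and>
      (\<forall>a :: nat \<Rightarrow> complex. poly_eval a (skew_H m indet) = skew_H m a) \<and>
      (\<forall>a :: nat \<Rightarrow> complex. skew_H m a \<noteq> 0 \<longrightarrow>
         min_recurrence_degree (skew_D m a) (2 * 3 ^ (m - 1))) \<and>
      {a :: nat \<Rightarrow> complex. \<exists>d' < 2 * 3 ^ (m - 1). min_recurrence_degree (skew_D m a) d'}
        \<subseteq> {a. skew_H m a = 0} \<and>
      {a :: nat \<Rightarrow> complex. skew_H m a = 0} \<subset> UNIV)"
proof -
  obtain k where k: "m = Suc k" using assms by (cases m) auto
  obtain a :: "nat \<Rightarrow> real" where a: "sym_H m a \<noteq> 0"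
    using ex_sym_H_neq_0 by blast
  obtain b :: "nat \<Rightarrow> real" where b: "skew_H m b \<noteq> 0"
    using ex_skew_H_neq_0 unfolding k by blast
  \<comment> \<open>The embedding of the reals is an injective ring homomorphism, so nonvanishing
    carries over to a complex point.\<close>
  have a': "sym_H m (\<lambda>i. complex_of_real (a i)) \<noteq> 0"
    using a by (simp flip: of_real_hom.hom_sym_H)
  have b': "skew_H m (\<lambda>i. complex_of_real (b i)) \<noteq> 0"
    using b by (simp flip: of_real_hom.hom_skew_H)
  \<comment> \<open>A polynomial with a nonzero value is nonzero.\<close>
  have sym: "sym_H m indet \<noteq> 0"
    using a' poly_eval_sym_H[of _ m] by (metis poly_eval_0)
  have skew: "skew_H m indet \<noteq> 0"
    using b' poly_eval_skew_H[of _ m] by (metis poly_eval_0)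
  have sym_min: "min_recurrence_degree (sym_D m a) ((3 ^ m + 1) div 2)"
    if "sym_H m a \<noteq> 0" for a :: "nat \<Rightarrow> complex"
    using that minors_vanish_sym_D[OF assms] by (intro min_recurrence_degreeI) (auto simp: sym_H_def)
  have skew_min: "min_recurrence_degree (skew_D m a) (2 * 3 ^ (m - 1))"
    if "skew_H m a \<noteq> 0" for a :: "nat \<Rightarrow> complex"
    using that minors_vanish_skew_D[of k a] by (intro min_recurrence_degreeI) (auto simp: skew_H_def k)
  have sym_drop: "sym_H m a = 0" if "min_recurrence_degree (sym_D m a) d'" "d' < (3 ^ m + 1) div 2"
    for a :: "nat \<Rightarrow> complex" and d'
    using that hankel_det_eq_0_if_recurrence unfolding min_recurrence_degree_def sym_H_def by blast
  have skew_drop: "skew_H m a = 0" if "min_recurrence_degree (skew_D m a) d'" "d' < 2 * 3 ^ (m - 1)"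
    for a :: "nat \<Rightarrow> complex" and d'
    using that hankel_det_eq_0_if_recurrence unfolding min_recurrence_degree_def skew_H_def by blast
  show ?thesis
    using poly_vars_sym_H[of m] poly_vars_skew_H[of m] sym skew sym_min skew_min sym_drop skew_drop a' b'
    by (intro conjI allI impI poly_eval_sym_H poly_eval_skew_H subsetI psubsetI) auto
qed

end
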